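(* Let $\lambda$ be a regular cardinal. Then for every cardinal $\mu$ with $\mu^+<\lambda$ there is a surjective homomorphism $\Phi_\mu:\langle\mathcal G_\lambda,\le_w\rangle\to\langle[\mu^{\aleph_0}]^{\le\lambda},\subseteq\rangle$.
   Context: A ray is a one-way infinite path; two rays are tail-equivalent iff they share a common tail. $\mathcal G$ is the class of all graphs $G$ such that for every vertex $v$, the induced subgraph spanned by the neighbourhood $G[v]$ has at most one ray up to tail-equivalence; $\mathcal G_\lambda$ is the set of isomorphism types of members of $\mathcal G$ with exactly $\lambda$ vertices. $G_1\le_w G_2$ means $G_1$ is isomorphic to a (not necessarily induced) subgraph of $G_2$. For a cardinal $\kappa$ (viewed as a set), $[\kappa]^{\le\lambda}$ is the set of subsets of $\kappa$ of cardinality at most $\lambda$, ordered by inclusion. A homomorphism is an order-preserving map. *)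

theory Defs
  imports Main
begin

unbundle cardinal_syntax

text \<open>Graphs are simple, undirected and of arbitrary size: a vertex set together with a set of
  two-element sets of vertices.\<close>

type_synonym 'v graph = "'v set \<times> 'v set set"

abbreviation verts :: "'v graph \<Rightarrow> 'v set" where "verts \<equiv> fst"
abbreviation edges :: "'v graph \<Rightarrow> 'v set set" where "edges \<equiv> snd"

definition is_graph :: "'v graph \<Rightarrow> bool" where
  "is_graph G \<longleftrightarrow> edges G \<subseteq> {{u, v} |u v. u \<in> verts G \<and> v \<in> verts G \<and> u \<noteq> v}"

definition neighbours :: "'v graph \<Rightarrow> 'v \<Rightarrow> 'v set" where
  "neighbours G v = {u \<in> verts G. {v, u} \<in> edges G}"

definition induced :: "'v graph \<Rightarrow> 'v set \<Rightarrow> 'v graph" where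
  "induced G W = (verts G \<inter> W, {e \<in> edges G. e \<subseteq> W})"

definition is_subgraph :: "'v graph \<Rightarrow> 'v graph \<Rightarrow> bool" where
  "is_subgraph H G \<longleftrightarrow> is_graph H \<and> verts H \<subseteq> verts G \<and> edges H \<subseteq> edges G"

definition graph_iso :: "'v graph \<Rightarrow> 'w graph \<Rightarrow> bool" where
  "graph_iso G H \<longleftrightarrow> (\<exists>h. bij_betw h (verts G) (verts H) \<and> (`) h ` edges G = edges H)"

definition weakly_embeds :: "'v graph \<Rightarrow> 'w graph \<Rightarrow> bool" where
  "weakly_embeds G\<^sub>1 G\<^sub>2 \<longleftrightarrow> (\<exists>H. is_subgraph H G\<^sub>2 \<and> graph_iso G\<^sub>1 H)"

text \<open>A ray is determined by the enumeration of its vertices from its initial vertex.\<close>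

definition is_ray :: "'v graph \<Rightarrow> (nat \<Rightarrow> 'v) \<Rightarrow> bool" where
  "is_ray G r \<longleftrightarrow> inj r \<and> range r \<subseteq> verts G \<and> (\<forall>n. {r n, r (Suc n)} \<in> edges G)"

definition tail_equivalent :: "(nat \<Rightarrow> 'v) \<Rightarrow> (nat \<Rightarrow> 'v) \<Rightarrow> bool" where
  "tail_equivalent r s \<longleftrightarrow> (\<exists>m n. \<forall>k. r (m + k) = s (n + k))"

definition at_most_one_ray :: "'v graph \<Rightarrow> bool" where
  "at_most_one_ray G \<longleftrightarrow> (\<forall>r s. is_ray G r \<longrightarrow> is_ray G s \<longrightarrow> tail_equivalent r s)"

definition class_G :: "'v graph set" where
  "class_G = {G. is_graph G \<and> (\<forall>v \<in> verts G. at_most_one_ray (induced G (neighbours G v)))}"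

text \<open>Cardinals are represented by cardinal orders. Vertices of graphs with \<open>l\<close> many vertices are
  taken from the type underlying \<open>l\<close>; by \<open>class_G_representative\<close> below every isomorphism type
  is represented there.\<close>

definition graphs_of_size :: "'l rel \<Rightarrow> 'l graph set" where
  "graphs_of_size l = {G \<in> class_G. |verts G| =o l}"

definition iso_rel :: "'l rel \<Rightarrow> 'l graph rel" where
  "iso_rel l = {(G, H). G \<in> graphs_of_size l \<and> H \<in> graphs_of_size l \<and> graph_iso G H}"

definition iso_types :: "'l rel \<Rightarrow> 'l graph set set" where
  "iso_types l = graphs_of_size l // iso_rel l"

definition le_w :: "'l graph set \<Rightarrow> 'l graph set \<Rightarrow> bool" where
  "le_w X Y \<longleftrightarrow> (\<exists>G \<in> X. \<exists>H \<in> Y. weakly_embeds G H)"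

definition subsets_upto :: "'k rel \<Rightarrow> 'l rel \<Rightarrow> 'k set set" where
  "subsets_upto k l = {A. A \<subseteq> Field k \<and> |A| \<le>o l}"


lemma graph_iso_refl: "graph_iso G G"
  unfolding graph_iso_def by (rule exI[of _ id]) auto

lemma graph_iso_trans:
  assumes "graph_iso G H" "graph_iso H K" shows "graph_iso G K"
proof -
  obtain f where f: "bij_betw f (verts G) (verts H)" "(`) f ` edges G = edges H"
    using assms(1) unfolding graph_iso_def by blast
  obtain g where g: "bij_betw g (verts H) (verts K)" "(`) g ` edges H = edges K"
    using assms(2) unfolding graph_iso_def by blast
  have "(`) (g \<circ> f) ` edges G = edges K"
    unfolding g(2)[symmetric] f(2)[symmetric] by (simp add: image_image)
  then show ?thesis using bij_betw_trans[OF f(1) g(1)] unfolding graph_iso_def by blast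
qed

lemma is_graph_edge_subset: "is_graph G \<Longrightarrow> e \<in> edges G \<Longrightarrow> e \<subseteq> verts G"
  unfolding is_graph_def by auto

lemma graph_iso_sym:
  assumes "is_graph G" "graph_iso G H" shows "graph_iso H G"
proof -
  obtain f where f: "bij_betw f (verts G) (verts H)" "(`) f ` edges G = edges H"
    using assms(2) unfolding graph_iso_def by blast
  let ?g = "the_inv_into (verts G) f"
  have "?g ` f ` e = e" if "e \<in> edges G" for e
  proof -
    have "?g (f x) = x" if "x \<in> e" for x
      using is_graph_edge_subset[OF assms(1) \<open>e \<in> edges G\<close>] that f(1)
      by (auto simp: bij_betw_def intro: the_inv_into_f_f)
    then show ?thesis by (simp add: image_image)
  qed
  then have "(`) ?g ` edges H = edges G"
    unfolding f(2)[symmetric] by (simp add: image_image)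
  then show ?thesis using bij_betw_the_inv_into[OF f(1)] unfolding graph_iso_def by blast
qed

lemma is_graph_iso:
  assumes "is_graph G" "graph_iso G H" shows "is_graph H"
proof -
  obtain f where f: "bij_betw f (verts G) (verts H)" "(`) f ` edges G = edges H"
    using assms(2) unfolding graph_iso_def by blast
  show ?thesis unfolding is_graph_def
  proof
    fix e assume "e \<in> edges H"
    then obtain d where d: "d \<in> edges G" "e = f ` d"
      using f(2) by blast
    obtain u v where uv: "d = {u, v}" "u \<in> verts G" "v \<in> verts G" "u \<noteq> v"
      using d(1) assms(1) unfolding is_graph_def by blast
    then have "e = {f u, f v}" using d(2) by simp
    moreover have "f u \<in> verts H" "f v \<in> verts H" "f u \<noteq> f v"
      using f(1) uv unfolding bij_betw_def inj_on_def by auto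
    ultimately show "e \<in> {{u, v} |u v. u \<in> verts H \<and> v \<in> verts H \<and> u \<noteq> v}" by blast
  qed
qed

lemma equiv_iso_rel: "equiv (graphs_of_size l) (iso_rel l)"
proof (rule equivI)
  show "sym (iso_rel l)"
    by (auto simp: iso_rel_def sym_def graphs_of_size_def class_G_def intro: graph_iso_sym)
  show "trans (iso_rel l)"
    by (auto simp: iso_rel_def trans_def intro: graph_iso_trans)
qed (auto simp: iso_rel_def refl_on_def graph_iso_refl)

lemma weakly_embeds_cong:
  assumes "is_graph G" "graph_iso G G'" "is_graph H" "graph_iso H H'" "weakly_embeds G H"
  shows "weakly_embeds G' H'"
proof -
  obtain K where K: "is_graph K" "verts K \<subseteq> verts H" "edges K \<subseteq> edges H" "graph_iso G K"
    using assms(5) unfolding weakly_embeds_def is_subgraph_def by blast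
  obtain f where f: "bij_betw f (verts H) (verts H')" "(`) f ` edges H = edges H'"
    using assms(4) unfolding graph_iso_def by blast
  let ?K = "(f ` verts K, (`) f ` edges K)"
  have iso: "graph_iso K ?K"
    unfolding graph_iso_def using K(2) f(1)
    by (auto intro!: exI[of _ f] simp: bij_betw_def intro: inj_on_subset)
  have "is_subgraph ?K H'"
    using is_graph_iso[OF K(1) iso] image_mono[OF K(2), of f] image_mono[OF K(3), of "(`) f"] f
    unfolding is_subgraph_def bij_betw_def by simp
  moreover have "graph_iso G' ?K"
    using graph_iso_trans[OF graph_iso_sym[OF assms(1,2)] graph_iso_trans[OF K(4) iso]] .
  ultimately show ?thesis unfolding weakly_embeds_def by blast
qed

text \<open>The relation on isomorphism types does not depend on representatives.\<close>

lemma le_w_iff: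
  assumes "G \<in> graphs_of_size l" "H \<in> graphs_of_size l"
  shows "le_w (iso_rel l `` {G}) (iso_rel l `` {H}) \<longleftrightarrow> weakly_embeds G H"
proof
  have G: "is_graph G" and H: "is_graph H"
    using assms by (auto simp: graphs_of_size_def class_G_def)
  assume "le_w (iso_rel l `` {G}) (iso_rel l `` {H})"
  then obtain G' H' :: "'a graph"
    where iso: "graph_iso G G'" "graph_iso H H'" and emb: "weakly_embeds G' H'"
    unfolding le_w_def iso_rel_def by blast
  show "weakly_embeds G H"
    using weakly_embeds_cong[OF is_graph_iso[OF G iso(1)] graph_iso_sym[OF G iso(1)]
        is_graph_iso[OF H iso(2)] graph_iso_sym[OF H iso(2)] emb] .
next
  assume "weakly_embeds G H"
  then show "le_w (iso_rel l `` {G}) (iso_rel l `` {H})"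
    using equiv_class_self[OF equiv_iso_rel assms(1)] equiv_class_self[OF equiv_iso_rel assms(2)]
    unfolding le_w_def by blast
qed

lemma class_G_iso:
  assumes "G \<in> class_G" "graph_iso G H" shows "H \<in> class_G"
proof -
  have G: "is_graph G" and H: "is_graph H"
    using assms is_graph_iso[OF _ assms(2)] by (simp_all add: class_G_def)
  obtain g where g: "bij_betw g (verts H) (verts G)" "(`) g ` edges H = edges G"
    using graph_iso_sym[OF G assms(2)] unfolding graph_iso_def by blast
  have edge: "{g u, g v} \<in> edges G" if "{u, v} \<in> edges H" for u v
    using imageI[OF that, of "(`) g"] g(2) by simp
  have ray: "is_ray (induced G (neighbours G (g v))) (g \<circ> r)"
    if "is_ray (induced H (neighbours H v)) r" for v r
  proof -
    have r: "inj r" "range r \<subseteq> verts H" "\<And>n. {v, r n} \<in> edges H"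
        "\<And>n. {r n, r (Suc n)} \<in> edges H"
      using that unfolding is_ray_def induced_def neighbours_def by auto
    have "inj_on g (range r)" using g(1) r(2) by (auto simp: bij_betw_def intro: inj_on_subset)
    then have "inj (g \<circ> r)" using r(1) by (rule comp_inj_on[rotated])
    moreover have "range (g \<circ> r) \<subseteq> verts G"
      using g(1) image_mono[OF r(2), of g] by (simp add: bij_betw_def image_comp)
    ultimately show ?thesis using r(3,4) edge
      unfolding is_ray_def induced_def neighbours_def by auto
  qed
  have "tail_equivalent r s"
    if v: "v \<in> verts H" and rs: "is_ray (induced H (neighbours H v)) r"
      "is_ray (induced H (neighbours H v)) s" for v r s
  proof -
    have "g v \<in> verts G" using v g(1) by (auto simp: bij_betw_def)
    then have "tail_equivalent (g \<circ> r) (g \<circ> s)"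
      using assms(1) ray[OF rs(1)] ray[OF rs(2)] unfolding class_G_def at_most_one_ray_def by blast
    moreover have "range r \<subseteq> verts H" "range s \<subseteq> verts H"
      using rs unfolding is_ray_def induced_def by auto
    then have "g (r i) = g (s j) \<longleftrightarrow> r i = s j" for i j
      using g(1) by (auto simp: bij_betw_def inj_on_eq_iff subset_iff)
    ultimately show ?thesis unfolding tail_equivalent_def by simp
  qed
  then show ?thesis using H unfolding class_G_def at_most_one_ray_def by blast
qed

lemma class_G_representative:
  fixes G :: "'v graph" and l :: "'l rel"
  assumes "G \<in> class_G" "Card_order l" "|verts G| =o l"
  shows "\<exists>H \<in> graphs_of_size l. graph_iso G H"
proof -
  have "|verts G| =o |Field l|"
    using assms(2,3) card_of_Field_ordIso ordIso_symmetric ordIso_transitive by blast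
  then obtain f where f: "bij_betw f (verts G) (Field l)" using card_of_ordIso by blast
  let ?H = "(Field l, (`) f ` edges G)"
  have iso: "graph_iso G ?H" unfolding graph_iso_def using f by auto
  moreover have "?H \<in> graphs_of_size l"
    using class_G_iso[OF assms(1) iso] card_of_Field_ordIso[OF assms(2)]
    by (simp add: graphs_of_size_def)
  ultimately show ?thesis by blast
qed

end

theory Submission
  imports Defs "HOL-Library.FuncSet"
begin

text \<open>
  Embeddings are injective and a neighbourhood contains only one ray up to tails, so a ray in the
  neighbourhood of a vertex is carried to the essentially unique ray in the neighbourhood of its image.

  If \<open>\<mu>\<^sup>\<omega> \<le> 2\<^sup>\<omega>\<close>, a binary sequence is coded by the coincidence pattern of the rays at two vertices.
  Otherwise \<open>\<lambda>\<close> is uncountable. Enumerating the vertices by \<open>\<lambda>\<close>, a ray may converge to an ordinal of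
  cofinality \<open>\<omega>\<close>, and for any two enumerations the limits agree on a club. A vertex whose ray
  consists of vertices which again have rays thus codes an \<open>\<omega>\<close>-sequence of such ordinals. The invariant
  of a graph consists of the colours which are coded, in every enumeration, by some vertex. Colours are
  supplied by Solovay's splitting of the points of cofinality \<open>\<omega>\<close> if \<open>\<mu>\<^sup>\<omega> \<le> \<lambda>\<close>, and by a family of
  \<open>\<lambda>\<close> many sets of size \<open>\<mu>\<close>, one of which is contained in any given club, if \<open>\<lambda> < \<mu>\<^sup>\<omega>\<close>.
\<close>

text \<open>Embeddings need not preserve non-edges, so an invariant may only use facts that survive
  in a larger graph: rays in neighbourhoods, and equality or inequality of vertices. That such a ray
  is unique up to tails gives the bounds from above: \<lambda> vertices admit at most \<lambda> rays
  in neighbourhoods, so at most \<lambda> colours are read off. The binary case stands apart because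
  for finite \<mu> the cardinal \<lambda> may be countable, and then no point below it has
  cofinality \<omega>. Otherwise the gap between \<open>\<mu>\<^sup>+\<close> and \<lambda> keeps
  constructions of length \<open>\<mu>\<^sup>+\<close> bounded in \<lambda>, which is what Shelah's
  club guessing rests on. An enumeration is controlled only on a club that depends on it. A colour
  is therefore not tied to a single sequence: it owns a family of sequences, one of which lies in
  any given club. Families of different colours must stay apart even up to tails, since a ray may be
  entered at any of its vertices.\<close>

lemma card_of_Times_bound:
  assumes "Cinfinite r" "|A| \<le>o r" "|B| \<le>o r"
  shows "|A \<times> B| \<le>o r"
  using assms by (intro card_of_Times_ordLeq_infinite_Field) (auto simp: cinfinite_def)

lemma card_of_lists_infinite:
  assumes "infinite A"
  shows "|lists A| \<le>o |A|"
proof -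
  have len: "|{xs \<in> lists A. length xs = n}| \<le>o |A|" for n
  proof (induction n)
    case 0
    have "|{xs \<in> lists A. length xs = 0}| \<le>o |{[] :: 'a list}|"
      by (rule card_of_mono1) auto
    also have "|{[] :: 'a list}| \<le>o |A|"
      using assms by (intro card_of_singl_ordLeq) auto
    finally show ?case .
  next
    case (Suc n)
    have "{xs \<in> lists A. length xs = Suc n}
        \<subseteq> (\<lambda>(x, xs). x # xs) ` (A \<times> {xs \<in> lists A. length xs = n})"
      by (auto simp: length_Suc_conv image_iff)
    then have "|{xs \<in> lists A. length xs = Suc n}| \<le>o |A \<times> {xs \<in> lists A. length xs = n}|"
      by (rule surj_imp_ordLeq)
    also have "|A \<times> {xs \<in> lists A. length xs = n}| \<le>o |A|"
      using assms Suc
      by (intro card_of_Times_bound) (auto simp: cinfinite_def Field_card_of card_of_card_order_on intro: ordLeq_refl)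
    finally show ?case .
  qed
  have "|\<Union>n\<in>(UNIV :: nat set). {xs \<in> lists A. length xs = n}| \<le>o |A|"
    using assms len by (intro card_of_UNION_ordLeq_infinite) (auto simp: infinite_iff_card_of_nat)
  moreover have "(\<Union>n\<in>(UNIV :: nat set). {xs \<in> lists A. length xs = n}) = lists A" by auto
  ultimately show ?thesis by simp
qed

lemma card_of_nat_bound: "Cinfinite r \<Longrightarrow> |A :: nat set| \<le>o r"
  by (meson card_of_mono1 subset_UNIV card_of_nat natLeq_ordLeq_cinfinite ordLeq_ordIso_trans
      ordLeq_transitive)

text \<open>A bound by \<open>r\<close> instead of \<open>|A|\<close> also covers finite
  \<open>A\<close>, which may have infinitely many lists.\<close>

lemma card_of_lists_bound:
  assumes "Cinfinite r" "|A| \<le>o r"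
  shows "|lists A| \<le>o r"
proof -
  have "|A| \<le>o |Field r|"
    using assms card_of_Field_ordIso ordIso_symmetric ordLeq_ordIso_trans by blast
  then obtain f where f: "inj_on f A" "f ` A \<subseteq> Field r" using card_of_ordLeq by metis
  have "|lists A| \<le>o |lists (Field r)|"
    by (rule card_of_ordLeqI[of "map f"]) (use f in \<open>auto intro!: inj_on_mapI intro: inj_on_subset simp: image_subset_iff\<close>)
  also have "|lists (Field r)| \<le>o |Field r|"
    using assms(1) by (intro card_of_lists_infinite) (simp add: cinfinite_def)
  also have "|Field r| =o r" using assms(1) by (simp add: card_of_Field_ordIso)
  finally show ?thesis .
qed

section \<open>Rays in neighbourhoods and their behaviour under embeddings\<close>

lemma is_ray_nbh:
  "is_ray (induced G (neighbours G v)) r \<longleftrightarrow>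
    inj r \<and> (\<forall>n. r n \<in> verts G \<and> {v, r n} \<in> edges G \<and> {r n, r (Suc n)} \<in> edges G)"
  unfolding is_ray_def induced_def neighbours_def by auto

lemma weakly_embedsE:
  assumes "weakly_embeds G H"
  obtains f where "inj_on f (verts G)" "f ` verts G \<subseteq> verts H"
    "\<And>u v. {u, v} \<in> edges G \<Longrightarrow> {f u, f v} \<in> edges H"
proof -
  obtain K where K: "verts K \<subseteq> verts H" "edges K \<subseteq> edges H" "graph_iso G K"
    using assms unfolding weakly_embeds_def is_subgraph_def by blast
  obtain f where f: "bij_betw f (verts G) (verts K)" "(`) f ` edges G = edges K"
    using K(3) unfolding graph_iso_def by blast
  have "{f u, f v} \<in> edges H" if "{u, v} \<in> edges G" for u v
    using imageI[OF that, of "(`) f"] f(2) K(2) by auto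
  then show ?thesis using that[of f] f(1) K(1) by (auto simp: bij_betw_def)
qed

lemma graph_iso_imp_weakly_embeds:
  "is_graph G \<Longrightarrow> graph_iso G H \<Longrightarrow> weakly_embeds G H"
  unfolding weakly_embeds_def is_subgraph_def using is_graph_iso by blast

text \<open>Rays need not be induced paths, so additional edges of \<open>H\<close> do no harm.
  Together with injectivity this is what makes both invariants monotone.\<close>

lemma ray_nbh_image:
  assumes "inj_on f (verts G)" "f ` verts G \<subseteq> verts H"
    "\<And>u v. {u, v} \<in> edges G \<Longrightarrow> {f u, f v} \<in> edges H"
    and "is_ray (induced G (neighbours G v)) r"
  shows "is_ray (induced H (neighbours H (f v))) (f \<circ> r)"
proof -
  have r: "inj r" "range r \<subseteq> verts G" using assms(4) by (auto simp: is_ray_nbh)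
  have "inj (f \<circ> r)" using r assms(1) by (meson comp_inj_on inj_on_subset)
  moreover have "f (r n) \<in> verts H" "{f v, f (r n)} \<in> edges H" "{f (r n), f (r (Suc n))} \<in> edges H" for n
    using assms(2,4) r(2) by (auto simp: is_ray_nbh intro!: assms(3))
  ultimately show ?thesis by (simp add: is_ray_nbh)
qed

text \<open>A ray in a neighbourhood is a finite list of vertices followed by a tail of one fixed ray.\<close>

lemma card_of_nbh_rays:
  assumes G: "G \<in> class_G" and r: "Cinfinite r" "|verts G| \<le>o r"
  shows "|{q. \<exists>v\<in>verts G. is_ray (induced G (neighbours G v)) q}| \<le>o r" (is "|?R| \<le>o r")
proof -
  define q0 where "q0 v = (SOME q. is_ray (induced G (neighbours G v)) q)" for v
  define dec where "dec = (\<lambda>(v, xs, n). \<lambda>k. if k < length xs then xs ! k else q0 v (n + (k - length xs)))"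
  have "?R \<subseteq> dec ` (verts G \<times> lists (verts G) \<times> (UNIV :: nat set))"
  proof
    fix q assume "q \<in> ?R"
    then obtain v where v: "v \<in> verts G" and q: "is_ray (induced G (neighbours G v)) q" by blast
    from q have "is_ray (induced G (neighbours G v)) (q0 v)" unfolding q0_def by (rule someI[where P = "is_ray _"])
    then obtain i j where ij: "\<And>k. q (i + k) = q0 v (j + k)"
      using G v q unfolding class_G_def at_most_one_ray_def tail_equivalent_def by blast
    have "q = dec (v, map q [0..<i], j)"
    proof
      fix k show "q k = dec (v, map q [0..<i], j) k"
        using ij[of "k - i"] by (auto simp: dec_def)
    qed
    moreover have "map q [0..<i] \<in> lists (verts G)" using q by (auto simp: is_ray_nbh)
    ultimately show "q \<in> dec ` (verts G \<times> lists (verts G) \<times> UNIV)" using v by blast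
  qed
  then have "|?R| \<le>o |verts G \<times> lists (verts G) \<times> (UNIV :: nat set)|"
    by (rule surj_imp_ordLeq)
  also have "|verts G \<times> lists (verts G) \<times> (UNIV :: nat set)| \<le>o r"
    using r by (intro card_of_Times_bound card_of_lists_bound card_of_nat_bound)
  finally show ?thesis .
qed

text \<open>Turning round would revisit the number just left, so an injective walk that steps down
  once would have to descend forever.\<close>

lemma nat_path_ray:
  fixes k :: "nat \<Rightarrow> nat"
  assumes inj: "inj k" and step: "\<And>n. k (Suc n) = Suc (k n) \<or> k n = Suc (k (Suc n))"
  shows "k n = k 0 + n"
proof -
  have up: "k (Suc n) = Suc (k n)" for n
  proof (rule ccontr)
    assume n: "k (Suc n) \<noteq> Suc (k n)"
    have "k (n + i) = Suc (k (Suc (n + i)))" for i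
    proof (induction i)
      case 0
      then show ?case using step[of n] n by simp
    next
      case (Suc i)
      have "k (Suc (Suc (n + i))) \<noteq> k (n + i)" using inj_eq[OF inj] by simp
      then show ?case using Suc step[of "Suc (n + i)"] by (metis add_Suc_right nat.inject)
    qed
    note down = this
    have "k (n + i) + i = k n" for i
    proof (induction i)
      case (Suc i)
      then show ?case unfolding down[of i] by simp
    qed simp
    from this[of "Suc (k n)"] show False by simp
  qed
  show ?thesis by (induction n) (auto simp: up)
qed

lemma surjective_hom_of_invariant:
  fixes l :: "'l rel" and \<Psi> :: "'l graph \<Rightarrow> 'k set" and M :: "'m set"
  assumes mono: "\<And>G H. G \<in> graphs_of_size l \<Longrightarrow> H \<in> graphs_of_size l \<Longrightarrow> weakly_embeds G H \<Longrightarrow> \<Psi> G \<subseteq> \<Psi> H"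
    and card: "\<And>G. G \<in> graphs_of_size l \<Longrightarrow> |\<Psi> G| \<le>o l"
    and onto: "\<And>A. A \<subseteq> K \<Longrightarrow> |A| \<le>o l \<Longrightarrow> \<exists>G\<in>graphs_of_size l. \<Psi> G = A"
    and M: "|M| \<le>o |K|"
  shows "\<exists>\<Phi> :: 'l graph set \<Rightarrow> 'm set. monotone_on (iso_types l) le_w (\<subseteq>) \<Phi> \<and>
    \<Phi> ` iso_types l = {A. A \<subseteq> M \<and> |A| \<le>o l}"
proof -
  obtain i where i: "inj_on i M" "i ` M \<subseteq> K" using M card_of_ordLeq by metis
  define rep where "rep X = (SOME G :: 'l graph. G \<in> X)" for X
  define \<Phi> where "\<Phi> X = {a \<in> M. i a \<in> \<Psi> (rep X)}" for X
  have rep: "rep X \<in> X \<and> rep X \<in> graphs_of_size l" "X = iso_rel l `` {rep X}" if "X \<in> iso_types l" for X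
  proof -
    obtain G where G: "G \<in> graphs_of_size l" "X = iso_rel l `` {G}"
      using \<open>X \<in> iso_types l\<close> unfolding iso_types_def quotient_def by blast
    then have "G \<in> X" using equiv_class_self[OF equiv_iso_rel] by blast
    then have X: "rep X \<in> X" unfolding rep_def by (rule someI)
    then have GX: "(G, rep X) \<in> iso_rel l" using G by blast
    then show "rep X \<in> X \<and> rep X \<in> graphs_of_size l" using X by (simp add: iso_rel_def)
    show "X = iso_rel l `` {rep X}" using G(2) equiv_class_eq[OF equiv_iso_rel GX] by simp
  qed
  have "monotone_on (iso_types l) le_w (\<subseteq>) \<Phi>"
  proof (rule monotone_onI)
    fix X Y assume X: "X \<in> iso_types l" and Y: "Y \<in> iso_types l" and le: "le_w X Y"
    have "weakly_embeds (rep X) (rep Y)"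
      using le le_w_iff[of "rep X" l "rep Y"] rep(1)[OF X] rep(1)[OF Y]
      unfolding rep(2)[OF X, symmetric] rep(2)[OF Y, symmetric] by blast
    then show "\<Phi> X \<subseteq> \<Phi> Y" using mono rep(1)[OF X] rep(1)[OF Y] unfolding \<Phi>_def by blast
  qed
  moreover have "\<Phi> ` iso_types l = {A. A \<subseteq> M \<and> |A| \<le>o l}"
  proof (intro equalityI subsetI)
    fix A assume "A \<in> \<Phi> ` iso_types l"
    then obtain X where X: "X \<in> iso_types l" "A = \<Phi> X" by blast
    have "|\<Phi> X| \<le>o |\<Psi> (rep X)|"
      by (rule card_of_ordLeqI[of i]) (use i in \<open>auto simp: \<Phi>_def intro: inj_on_subset\<close>)
    also have "|\<Psi> (rep X)| \<le>o l" using card rep(1)[OF X(1)] by blast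
    finally show "A \<in> {A. A \<subseteq> M \<and> |A| \<le>o l}" using X by (auto simp: \<Phi>_def)
  next
    fix A assume "A \<in> {A. A \<subseteq> M \<and> |A| \<le>o l}"
    then have A: "A \<subseteq> M" "|A| \<le>o l" by auto
    have "|i ` A| \<le>o l" using card_of_image A(2) ordLeq_transitive by blast
    then obtain G where G: "G \<in> graphs_of_size l" "\<Psi> G = i ` A"
      using onto[of "i ` A"] A(1) i(2) by blast
    let ?X = "iso_rel l `` {G}"
    have X: "?X \<in> iso_types l" using G(1) unfolding iso_types_def by (rule quotientI)
    have iso: "graph_iso G (rep ?X)" using rep(1)[OF X] by (auto simp: iso_rel_def)
    have R: "rep ?X \<in> graphs_of_size l" using rep(1)[OF X] by blast
    have gr: "is_graph G" "is_graph (rep ?X)" using G(1) R by (auto simp: graphs_of_size_def class_G_def)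
    have "\<Psi> (rep ?X) = i ` A"
      using mono[OF G(1) R graph_iso_imp_weakly_embeds[OF gr(1) iso]]
        mono[OF R G(1) graph_iso_imp_weakly_embeds[OF gr(2) graph_iso_sym[OF gr(1) iso]]] G(2) by blast
    then have "\<Phi> ?X = A" using A(1) inj_on_image_mem_iff[OF i(1)] unfolding \<Phi>_def by blast
    then show "A \<in> \<Phi> ` iso_types l" using X by blast
  qed
  ultimately show ?thesis by blast
qed

text \<open>Reading off indices along \<open>p\<close> turns \<open>r\<close> into an injective walk
  on the natural numbers.\<close>

lemma ray_in_path:
  assumes "inj p" "\<And>i j. {p i, p j} \<in> E \<Longrightarrow> j = Suc i \<or> i = Suc j"
    and "inj r" "\<And>n. r n \<in> range p" "\<And>n. {r n, r (Suc n)} \<in> E"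
  shows "\<exists>j. \<forall>n. r n = p (j + n)"
proof -
  obtain k where k: "\<And>n. r n = p (k n)" using assms(4) unfolding image_iff by metis
  have "inj k" using assms(3) k by (metis injD injI)
  moreover have "k (Suc n) = Suc (k n) \<or> k n = Suc (k (Suc n))" for n
    using assms(2)[of "k n" "k (Suc n)"] assms(5)[of n] k by simp
  ultimately have "k n = k 0 + n" for n by (rule nat_path_ray)
  then show ?thesis using k by metis
qed

lemma no_ray_if_finite_nbh:
  assumes "finite {u. {v, u} \<in> edges G}"
  shows "\<not> is_ray (induced G (neighbours G v)) r"
proof
  assume "is_ray (induced G (neighbours G v)) r"
  then have "inj r" "range r \<subseteq> {u. {v, u} \<in> edges G}" by (auto simp: is_ray_nbh)
  then show False using assms finite_subset finite_imageD by blast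
qed

lemma tail_equivalent_shifts:
  assumes "\<forall>n. r n = p (i + n)" "\<forall>n. s n = p (j + n)"
  shows "tail_equivalent r s"
  unfolding tail_equivalent_def
  by (rule exI[of _ j], rule exI[of _ i]) (simp add: assms add.left_commute)

section \<open>Binary sequences\<close>

text \<open>\<open>Pad\<close> provides isolated vertices, which bring the graph to full size even
  for small or empty sets of sequences.\<close>

datatype 'a fan_vertex = HubR "nat \<Rightarrow> bool" | HubS "nat \<Rightarrow> bool"
  | RimR "nat \<Rightarrow> bool" nat | RimS "nat \<Rightarrow> bool" nat | Pad 'a

text \<open>The sequence \<open>1, 1, 0, x 0, 0, x 1, 0, \<dots>\<close>: two consecutive ones occur only at the start, so it
  is not a proper shift of another such sequence.\<close>

definition marked :: "(nat \<Rightarrow> bool) \<Rightarrow> nat \<Rightarrow> bool" where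
  "marked x n \<longleftrightarrow> n < 2 \<or> odd n \<and> x ((n - 3) div 2)"

lemma marked_start: "marked x 0" "marked x 1" "\<not> marked x 2"
  by (auto simp: marked_def)

lemma marked_pair: "marked x i \<Longrightarrow> marked x (Suc i) \<Longrightarrow> i = 0"
  by (auto simp: marked_def)

lemma marked_inj: "(\<And>n. marked x n = marked y n) \<Longrightarrow> x = y"
proof
  fix m assume "\<And>n. marked x n = marked y n"
  from this[of "2 * m + 3"] show "x m = y m" by (simp add: marked_def)
qed

definition rim2 :: "(nat \<Rightarrow> bool) \<Rightarrow> nat \<Rightarrow> 'a fan_vertex" where
  "rim2 x n = (if marked x n then RimR x n else RimS x n)"

text \<open>For each \<open>x\<close> there are two hubs whose neighbourhoods are rays, and the \<open>n\<close>-th vertices of these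
  rays coincide exactly when \<open>marked x n\<close>; injectivity makes embeddings respect this pattern.\<close>

definition twin_fans :: "(nat \<Rightarrow> bool) set \<Rightarrow> 'a set \<Rightarrow> 'a fan_vertex graph" where
  "twin_fans A P =
    (HubR ` A \<union> HubS ` A \<union> case_prod RimR ` (A \<times> UNIV) \<union> case_prod RimS ` (A \<times> UNIV) \<union> Pad ` P,
     {{HubR x, RimR x n} |x n. x \<in> A} \<union> {{HubS x, rim2 x n} |x n. x \<in> A} \<union>
     {{RimR x n, RimR x (Suc n)} |x n. x \<in> A} \<union> {{rim2 x n, rim2 x (Suc n)} |x n. x \<in> A})"

definition twin_patterns :: "'v graph \<Rightarrow> (nat \<Rightarrow> bool) set" where
  "twin_patterns G = {x. \<exists>v\<in>verts G. \<exists>w\<in>verts G. \<exists>r s. is_ray (induced G (neighbours G v)) r \<and>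
    is_ray (induced G (neighbours G w)) s \<and> (\<forall>n. r n = s n \<longleftrightarrow> marked x n)}"

lemma twin_patterns_mono:
  assumes "weakly_embeds G H"
  shows "twin_patterns G \<subseteq> twin_patterns H"
proof
  obtain f where f: "inj_on f (verts G)" "f ` verts G \<subseteq> verts H"
    "\<And>u v. {u, v} \<in> edges G \<Longrightarrow> {f u, f v} \<in> edges H"
    using weakly_embedsE[OF assms] by blast
  fix x assume "x \<in> twin_patterns G"
  then obtain v w r s where vw: "v \<in> verts G" "w \<in> verts G"
    and r: "is_ray (induced G (neighbours G v)) r" and s: "is_ray (induced G (neighbours G w)) s"
    and eq: "\<And>n. r n = s n \<longleftrightarrow> marked x n"
    unfolding twin_patterns_def by blast
  have "r n \<in> verts G" "s n \<in> verts G" for n using r s by (auto simp: is_ray_nbh)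
  then have "(f \<circ> r) n = (f \<circ> s) n \<longleftrightarrow> marked x n" for n
    using f(1) eq by (simp add: inj_on_eq_iff)
  moreover have "f v \<in> verts H" "f w \<in> verts H" using vw f(2) by auto
  ultimately show "x \<in> twin_patterns H"
    unfolding twin_patterns_def using ray_nbh_image[OF f r] ray_nbh_image[OF f s] by blast
qed

text \<open>Although there may be more binary sequences than \<open>r\<close>, each pattern is
  determined by a pair of rays, and rays are few.\<close>

lemma twin_patterns_card:
  assumes "G \<in> class_G" "Cinfinite r" "|verts G| \<le>o r"
  shows "|twin_patterns G| \<le>o r"
proof -
  let ?R = "{q. \<exists>v\<in>verts G. is_ray (induced G (neighbours G v)) q}"
  define read :: "(nat \<Rightarrow> 'a) \<times> (nat \<Rightarrow> 'a) \<Rightarrow> nat \<Rightarrow> bool"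
    where "read = (\<lambda>(r, s). SOME x. \<forall>n. r n = s n \<longleftrightarrow> marked x n)"
  have "twin_patterns G \<subseteq> read ` (?R \<times> ?R)"
  proof
    fix x assume "x \<in> twin_patterns G"
    then obtain r s where rs: "(r, s) \<in> ?R \<times> ?R" and eq: "\<forall>n. r n = s n \<longleftrightarrow> marked x n"
      unfolding twin_patterns_def by blast
    have "\<forall>n. r n = s n \<longleftrightarrow> marked (read (r, s)) n"
      unfolding read_def prod.case by (rule someI[where P = "\<lambda>x. \<forall>n. r n = s n \<longleftrightarrow> marked x n", OF eq])
    then have "marked (read (r, s)) n = marked x n" for n using eq by blast
    then have "read (r, s) = x" by (rule marked_inj)
    then show "x \<in> read ` (?R \<times> ?R)" using rs by blast
  qed
  then have "|twin_patterns G| \<le>o |?R \<times> ?R|" by (rule surj_imp_ordLeq)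
  also have "|?R \<times> ?R| \<le>o r"
    using assms by (intro card_of_Times_bound card_of_nbh_rays)
  finally show ?thesis .
qed

lemma rim2_eq_iff: "rim2 x m = rim2 y n \<longleftrightarrow> x = y \<and> m = n"
  by (auto simp: rim2_def)

lemma twin_fans_edges:
  "{HubR x, u} \<in> edges (twin_fans A P) \<longleftrightarrow> x \<in> A \<and> u \<in> range (RimR x)"
  "{HubS x, u} \<in> edges (twin_fans A P) \<longleftrightarrow> x \<in> A \<and> u \<in> range (rim2 x)"
  "{RimR x m, RimR y n} \<in> edges (twin_fans A P) \<Longrightarrow> n = Suc m \<or> m = Suc n"
  "{rim2 x m, rim2 y n} \<in> edges (twin_fans A P) \<Longrightarrow> n = Suc m \<or> m = Suc n"
  "{Pad a, u} \<notin> edges (twin_fans A P)"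
  by (auto simp: twin_fans_def rim2_def doubleton_eq_iff image_iff split: if_splits)

lemma twin_fans_finite_nbh:
  "finite {u. {RimR x n, u} \<in> edges (twin_fans A P)}" "finite {u. {RimS x n, u} \<in> edges (twin_fans A P)}"
proof -
  let ?F = "{HubR x, HubS x} \<union> (RimR x ` {n - 1, Suc n}) \<union> (rim2 x ` {n - 1, Suc n})"
  have "{u. {RimR x n, u} \<in> edges (twin_fans A P)} \<subseteq> ?F" "{u. {RimS x n, u} \<in> edges (twin_fans A P)} \<subseteq> ?F"
    by (auto simp: twin_fans_def rim2_def doubleton_eq_iff split: if_splits)
  moreover have "finite ?F" by simp
  ultimately show "finite {u. {RimR x n, u} \<in> edges (twin_fans A P)}"
    "finite {u. {RimS x n, u} \<in> edges (twin_fans A P)}" by (meson finite_subset)+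
qed

text \<open>A hub sees only its own rim, where adjacency forces consecutive indices; rim vertices
  have finite degree and pads have none.\<close>

lemma twin_fans_ray:
  assumes "is_ray (induced (twin_fans A P) (neighbours (twin_fans A P) v)) r"
  shows "\<exists>x\<in>A. v = HubR x \<and> (\<exists>j. \<forall>n. r n = RimR x (j + n)) \<or> v = HubS x \<and> (\<exists>j. \<forall>n. r n = rim2 x (j + n))"
proof -
  let ?G = "twin_fans A P"
  have r: "inj r" "\<And>n. {v, r n} \<in> edges ?G" "\<And>n. {r n, r (Suc n)} \<in> edges ?G"
    using assms by (auto simp: is_ray_nbh)
  show ?thesis
  proof (cases v)
    case (HubR x)
    then have "x \<in> A" "\<And>n. r n \<in> range (RimR x)" using r(2) by (auto simp: twin_fans_edges)
    moreover have "\<exists>j. \<forall>n. r n = RimR x (j + n)"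
      by (rule ray_in_path[where E = "edges ?G"])
        (use r calculation in \<open>auto simp: inj_on_def dest: twin_fans_edges(3)\<close>)
    ultimately show ?thesis using HubR by blast
  next
    case (HubS x)
    then have "x \<in> A" "\<And>n. r n \<in> range (rim2 x)" using r(2) by (auto simp: twin_fans_edges)
    moreover have "\<exists>j. \<forall>n. r n = rim2 x (j + n)"
      by (rule ray_in_path[where E = "edges ?G"])
        (use r calculation in \<open>auto simp: inj_on_def rim2_eq_iff dest: twin_fans_edges(4)\<close>)
    ultimately show ?thesis using HubS by blast
  next
    case (RimR x n)
    then show ?thesis using no_ray_if_finite_nbh[OF twin_fans_finite_nbh(1)] assms by blast
  next
    case (RimS x n)
    then show ?thesis using no_ray_if_finite_nbh[OF twin_fans_finite_nbh(2)] assms by blast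
  next
    case (Pad a)
    then show ?thesis using r(2)[of 0] by (simp add: twin_fans_edges(5))
  qed
qed

lemma twin_fans_is_graph: "is_graph (twin_fans A P)"
  unfolding is_graph_def
proof
  fix e assume "e \<in> edges (twin_fans A P)"
  then consider x n where "x \<in> A" "e = {HubR x, RimR x n}" | x n where "x \<in> A" "e = {HubS x, rim2 x n}"
    | x n where "x \<in> A" "e = {RimR x n, RimR x (Suc n)}" | x n where "x \<in> A" "e = {rim2 x n, rim2 x (Suc n)}"
    by (auto simp: twin_fans_def)
  then obtain u v where "e = {u, v}" "u \<in> verts (twin_fans A P)" "v \<in> verts (twin_fans A P)" "u \<noteq> v"
    by cases (auto simp: twin_fans_def rim2_def image_iff split: if_splits)
  then show "e \<in> {{u, v} |u v. u \<in> verts (twin_fans A P) \<and> v \<in> verts (twin_fans A P) \<and> u \<noteq> v}"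
    by blast
qed

lemma twin_fans_class: "twin_fans A P \<in> class_G"
  unfolding class_G_def at_most_one_ray_def
proof (intro CollectI conjI ballI allI impI)
  show "is_graph (twin_fans A P)" by (rule twin_fans_is_graph)
  fix v r s
  assume "is_ray (induced (twin_fans A P) (neighbours (twin_fans A P) v)) r"
    and "is_ray (induced (twin_fans A P) (neighbours (twin_fans A P) v)) s"
  from this[THEN twin_fans_ray] show "tail_equivalent r s"
    by (auto intro: tail_equivalent_shifts)
qed

text \<open>Two rims of the same kind coincide at all indices or at none, whereas a pattern starts
  with a one and has a zero at index 2. Rims of different kinds must belong to the same sequence and
  be shifted by the same amount \<open>i\<close>; the two leading ones then force
  \<open>i = 0\<close>.\<close>

lemma twin_patterns_twin_fans: "twin_patterns (twin_fans A P) = A"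
proof (intro equalityI subsetI)
  let ?G = "twin_fans A P"
  fix z assume "z \<in> twin_patterns ?G"
  then obtain v w r s where r: "is_ray (induced ?G (neighbours ?G v)) r"
    and s: "is_ray (induced ?G (neighbours ?G w)) s"
    and eq: "\<And>n. r n = s n \<longleftrightarrow> marked z n"
    unfolding twin_patterns_def by blast
  have nonconst: False if "\<And>n. r n = s n \<longleftrightarrow> c" for c
    using that eq marked_start[of z] by simp
  have key: "z \<in> A" if "x \<in> A" "\<And>n. marked z n \<longleftrightarrow> x = y \<and> i = j \<and> marked x (i + n)" for x y i j
  proof -
    have "marked x i" "marked x (Suc i)" using that(2)[of 0] that(2)[of 1] marked_start[of z] by auto
    then have "i = 0" by (rule marked_pair)
    then have "marked z n = marked x n" for n using that(2)[of n] that(2)[of 0] marked_start[of z] by auto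
    then show ?thesis using marked_inj[of z x] that(1) by blast
  qed
  from twin_fans_ray[OF r] obtain x i where x: "x \<in> A"
    and rx: "(\<forall>n. r n = RimR x (i + n)) \<or> (\<forall>n. r n = rim2 x (i + n))" by blast
  from twin_fans_ray[OF s] obtain y j where y: "y \<in> A"
    and sy: "(\<forall>n. s n = RimR y (j + n)) \<or> (\<forall>n. s n = rim2 y (j + n))" by blast
  from rx sy consider "\<And>n. r n = RimR x (i + n)" "\<And>n. s n = RimR y (j + n)"
    | "\<And>n. r n = rim2 x (i + n)" "\<And>n. s n = rim2 y (j + n)"
    | "\<And>n. r n = RimR x (i + n)" "\<And>n. s n = rim2 y (j + n)"
    | "\<And>n. r n = rim2 x (i + n)" "\<And>n. s n = RimR y (j + n)" by blast
  then show "z \<in> A"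
  proof cases
    case 1
    then have "r n = s n \<longleftrightarrow> x = y \<and> i = j" for n by simp
    then show ?thesis using nonconst by blast
  next
    case 2
    then have "r n = s n \<longleftrightarrow> x = y \<and> i = j" for n by (simp add: rim2_eq_iff)
    then show ?thesis using nonconst by blast
  next
    case 3
    then have "marked z n \<longleftrightarrow> x = y \<and> i = j \<and> marked x (i + n)" for n
      using eq[of n] by (auto simp: rim2_def split: if_splits)
    then show ?thesis using key x by blast
  next
    case 4
    then have "marked z n \<longleftrightarrow> x = y \<and> i = j \<and> marked x (i + n)" for n
      using eq[of n] by (auto simp: rim2_def split: if_splits)
    then show ?thesis using key x by blast
  qed
next
  let ?G = "twin_fans A P"
  fix x assume x: "x \<in> A"
  have "is_ray (induced ?G (neighbours ?G (HubR x))) (RimR x)"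
    using x by (auto simp: is_ray_nbh twin_fans_def inj_on_def)
  moreover have "is_ray (induced ?G (neighbours ?G (HubS x))) (rim2 x)"
    using x by (auto simp: is_ray_nbh twin_fans_def inj_on_def rim2_eq_iff) (auto simp: rim2_def image_iff)
  moreover have "RimR x n = rim2 x n \<longleftrightarrow> marked x n" for n by (simp add: rim2_def)
  moreover have "HubR x \<in> verts ?G" "HubS x \<in> verts ?G" using x by (auto simp: twin_fans_def)
  ultimately show "x \<in> twin_patterns ?G" unfolding twin_patterns_def by blast
qed

lemma twin_fans_card:
  assumes "Cinfinite l" "|A| \<le>o l"
  shows "|verts (twin_fans A (Field l))| =o l"
proof -
  have l: "|Field l| =o l" using assms(1) by (simp add: card_of_Field_ordIso)
  have "|verts (twin_fans A (Field l))| \<le>o l"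
    unfolding twin_fans_def fst_conv
    by (intro Un_Cinfinite_bound ordLeq_transitive[OF card_of_image] card_of_Times_bound
        card_of_nat_bound assms ordIso_imp_ordLeq[OF l])
  moreover have "|Field l| \<le>o |verts (twin_fans A (Field l))|"
    by (rule card_of_ordLeqI[of Pad]) (auto simp: twin_fans_def inj_on_def)
  ultimately show ?thesis
    using l by (meson ordIso_iff_ordLeq ordIso_symmetric ordIso_ordLeq_trans)
qed

theorem surjective_hom_binary:
  fixes l :: "'l rel" and M :: "'m set"
  assumes l: "Cinfinite l" and M: "|M| \<le>o |UNIV :: (nat \<Rightarrow> bool) set|"
  shows "\<exists>\<Phi> :: 'l graph set \<Rightarrow> 'm set. monotone_on (iso_types l) le_w (\<subseteq>) \<Phi> \<and>
    \<Phi> ` iso_types l = {A. A \<subseteq> M \<and> |A| \<le>o l}"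
proof (rule surjective_hom_of_invariant[OF _ _ _ M])
  show "|twin_patterns G| \<le>o l" if "G \<in> graphs_of_size l" for G
    using that l by (intro twin_patterns_card) (auto simp: graphs_of_size_def ordIso_imp_ordLeq)
  show "\<exists>G\<in>graphs_of_size l. twin_patterns G = A" if A: "|A| \<le>o l" for A
  proof -
    let ?G = "twin_fans A (Field l)"
    obtain H where H: "H \<in> graphs_of_size l" "graph_iso ?G H"
      using class_G_representative[OF twin_fans_class _ twin_fans_card] l A by blast
    have "twin_patterns H = twin_patterns ?G"
      using twin_patterns_mono graph_iso_imp_weakly_embeds H(2) graph_iso_sym[OF twin_fans_is_graph H(2)]
        is_graph_iso[OF twin_fans_is_graph H(2)] twin_fans_is_graph by (metis subset_antisym)
    then show ?thesis using H(1) twin_patterns_twin_fans by blast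
  qed
qed (rule twin_patterns_mono)

section \<open>Regular uncountable cardinals\<close>

text \<open>Convergence from strictly below, which forces \<open>y\<close> to be a limit of
  cofinality \<omega>. Monotonicity of \<open>z\<close> is not imposed, since an enumeration may
  list the vertices of a ray in any order.\<close>

definition order_lim :: "(nat \<Rightarrow> 'a::linorder) \<Rightarrow> 'a \<Rightarrow> bool" where
  "order_lim z y \<longleftrightarrow> (\<exists>N. \<forall>n\<ge>N. z n < y) \<and> (\<forall>x<y. \<exists>N. \<forall>n\<ge>N. x < z n)"

lemma order_lim_unique:
  assumes "order_lim z y" "order_lim z y'"
  shows "y = y'"
proof -
  have False if ab: "order_lim z a" "order_lim z b" "a < b" for a b
  proof -
    obtain M N where "\<forall>n\<ge>M. z n < a" "\<forall>n\<ge>N. a < z n" using ab unfolding order_lim_def by blast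
    then have "z (max M N) < a" "a < z (max M N)" by auto
    then show False by simp
  qed
  then show ?thesis using assms by (metis linorder_less_linear)
qed

lemma order_lim_tail: "order_lim (\<lambda>n. z (i + n)) y \<longleftrightarrow> order_lim z y"
proof -
  have "(\<exists>N. \<forall>n\<ge>N. P (i + n)) \<longleftrightarrow> (\<exists>N. \<forall>n\<ge>N. P n)" for P :: "nat \<Rightarrow> bool"
  proof
    assume "\<exists>N. \<forall>n\<ge>N. P (i + n)"
    then obtain N where "\<forall>n\<ge>N. P (i + n)" by blast
    then have "\<forall>n\<ge>i + N. P n" by (metis add_le_cancel_left le_Suc_ex nat_le_iff_add trans_le_add1)
    then show "\<exists>N. \<forall>n\<ge>N. P n" by blast
  qed (use trans_le_add2 in blast)
  from this[of "\<lambda>n. z n < y"] this[of "\<lambda>n. _ < z n"] show ?thesis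
    unfolding order_lim_def by simp
qed

text \<open>The cardinal is an initial segment of a type of class \<open>wellorder\<close>, so that
  order notation and \<open>LEAST\<close> are available. \<open>segment\<close> makes it an initial
  ordinal and \<open>bounded\<close> makes it regular.\<close>

locale regular_cardinal =
  fixes L :: "'a::wellorder set"
  assumes down: "y \<in> L \<Longrightarrow> x < y \<Longrightarrow> x \<in> L"
    and segment: "x \<in> L \<Longrightarrow> |{..<x}| <o |L|"
    and bounded: "X \<subseteq> L \<Longrightarrow> |X| <o |L| \<Longrightarrow> \<exists>b\<in>L. \<forall>x\<in>X. x < b"
    and uncountable: "natLeq <o |L|"
begin

lemma Cinfinite_L: "Cinfinite |L|"
  using cinfinite_mono[OF ordLess_imp_ordLeq[OF uncountable] natLeq_cinfinite] card_of_Card_order[of L]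
  by simp

lemma nat_card_less: "|A :: nat set| <o |L|"
  using uncountable card_of_nat_bound[OF natLeq_Cinfinite] ordLeq_ordLess_trans by blast

lemma image_bounded:
  assumes "|I| <o |L|" "\<And>i. i \<in> I \<Longrightarrow> g i \<in> L"
  shows "\<exists>b\<in>L. \<forall>i\<in>I. g i < b"
proof -
  have "|g ` I| <o |L|" using card_of_image assms(1) by (rule ordLeq_ordLess_trans)
  moreover have "g ` I \<subseteq> L" using assms(2) by blast
  ultimately show ?thesis using bounded[of "g ` I"] by simp
qed

lemma seq_bounded: "(\<And>n :: nat. z n \<in> L) \<Longrightarrow> \<exists>b\<in>L. \<forall>n. z n < b"
  using image_bounded[OF nat_card_less, of UNIV z] by blast

lemma greater_ex: "x \<in> L \<Longrightarrow> \<exists>y\<in>L. x < y"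
  using seq_bounded[of "\<lambda>_. x"] by blast

lemma down_le: "y \<in> L \<Longrightarrow> x \<le> y \<Longrightarrow> x \<in> L"
  using down by (cases "x = y") auto

lemma atMost_card_less: "x \<in> L \<Longrightarrow> |{..x}| <o |L|"
proof -
  assume "x \<in> L"
  then obtain y where y: "y \<in> L" "x < y" using greater_ex by blast
  then have "{..x} \<subseteq> {..<y}" by auto
  then show ?thesis using segment[OF y(1)] card_of_mono1 ordLeq_ordLess_trans by blast
qed

lemma card_of_unbounded:
  assumes "X \<subseteq> L" "\<And>b. b \<in> L \<Longrightarrow> \<exists>x\<in>X. b \<le> x"
  shows "|L| \<le>o |X|"
proof (rule ccontr)
  assume "\<not> |L| \<le>o |X|"
  then have "|X| <o |L|" by (simp add: not_ordLeq_iff_ordLess card_of_Well_order)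
  then obtain b where "b \<in> L" "\<forall>x\<in>X. x < b" using bounded[OF assms(1)] by blast
  then show False using assms(2)[of b] by fastforce
qed

text \<open>Closure points of a function into \<open>L\<close> form a club, and every club contains
  such a set up to the least element. Functions \<open>h \<in> L \<rightarrow> L\<close> therefore
  stand for clubs throughout.\<close>

definition Cl :: "('a \<Rightarrow> 'a) \<Rightarrow> 'a set" where
  "Cl h = {y \<in> L. \<forall>x<y. h x < y}"

lemma Cl_antimono: "(\<And>x. x \<in> L \<Longrightarrow> g x \<le> h x) \<Longrightarrow> Cl h \<subseteq> Cl g"
proof
  fix y assume le: "\<And>x. x \<in> L \<Longrightarrow> g x \<le> h x" and y: "y \<in> Cl h"
  have "g x < y" if "x < y" for x
  proof -
    have "g x \<le> h x" using y that by (auto simp: Cl_def intro!: le intro: down)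
    also have "h x < y" using that y unfolding Cl_def by simp
    finally show ?thesis .
  qed
  then show "y \<in> Cl g" using y unfolding Cl_def by simp
qed

text \<open>This replaces the intersection of fewer than \<lambda> clubs: by
  \<open>Cl_antimono\<close>, \<open>Cl g\<close> lies in each \<open>Cl (h i)\<close>.\<close>

lemma common_bound:
  assumes "|I| <o |L|" "\<And>i. i \<in> I \<Longrightarrow> h i \<in> L \<rightarrow> L"
  shows "\<exists>g \<in> L \<rightarrow> L. \<forall>i\<in>I. \<forall>x\<in>L. h i x < g x"
proof -
  have "\<forall>x\<in>L. \<exists>b\<in>L. \<forall>i\<in>I. h i x < b"
  proof
    fix x assume "x \<in> L"
    then show "\<exists>b\<in>L. \<forall>i\<in>I. h i x < b"
      using image_bounded[OF assms(1), of "\<lambda>i. h i x"] assms(2) by blast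
  qed
  then obtain g where "\<forall>x\<in>L. g x \<in> L \<and> (\<forall>i\<in>I. h i x < g x)" unfolding Bex_def by metis
  then show ?thesis by (intro bexI[of _ g]) auto
qed

text \<open>These are the points of cofinality \<omega>.\<close>

definition ladder_points :: "'a set" where
  "ladder_points = {y \<in> L. \<exists>z. (\<forall>n. z n < y) \<and> order_lim z y}"

definition ladder :: "'a \<Rightarrow> nat \<Rightarrow> 'a" where
  "ladder y = (SOME z. (\<forall>n. z n < y) \<and> order_lim z y)"

lemma ladder_points_L: "y \<in> ladder_points \<Longrightarrow> y \<in> L"
  by (simp add: ladder_points_def)

lemma ladder:
  assumes "y \<in> ladder_points"
  shows "ladder y n < y" "order_lim (ladder y) y"
  using assms someI_ex[of "\<lambda>z. (\<forall>n. z n < y) \<and> order_lim z y"]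
  unfolding ladder_points_def ladder_def by blast+

lemma ladder_L: "y \<in> ladder_points \<Longrightarrow> ladder y n \<in> L"
  using ladder(1) ladder_points_L down by blast

lemma strict_mono_limit:
  fixes z :: "nat \<Rightarrow> 'a"
  assumes z: "strict_mono z" "\<And>n. z n \<in> L"
  shows "\<exists>y\<in>ladder_points. (\<forall>n. z n < y) \<and> (\<forall>x<y. \<exists>n. x < z n)"
proof -
  define y where "y = (LEAST y. \<forall>n. z n < y)"
  obtain b where b: "b \<in> L" "\<forall>n. z n < b" using seq_bounded[of z] z(2) by blast
  have y: "\<forall>n. z n < y" unfolding y_def using b(2) by (rule LeastI)
  have yb: "y \<le> b" unfolding y_def using b(2) by (rule Least_le)
  have lim: "\<exists>n. x < z n" if "x < y" for x
  proof -
    have "\<not> (\<forall>n. z n < x)" using that not_less_Least unfolding y_def by blast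
    then obtain n where "x \<le> z n" by (auto simp: not_less)
    also have "z n < z (Suc n)" using z(1) by (simp add: strict_mono_Suc_iff)
    finally show ?thesis by blast
  qed
  have "\<exists>N. \<forall>n\<ge>N. x < z n" if "x < y" for x
    using lim[OF that] z(1) by (meson less_le_trans strict_mono_less_eq)
  then have "order_lim z y" using y unfolding order_lim_def by blast
  then have "y \<in> ladder_points" using y yb b(1) down_le unfolding ladder_points_def by blast
  then show ?thesis using y lim by blast
qed

text \<open>Closing off under \<open>h\<close> in \<omega> steps leads to a supremum of cofinality
  \<omega>, so the closure point obtained is a ladder point as well.\<close>

lemma Cl_unbounded:
  assumes h: "h \<in> L \<rightarrow> L" and a: "a \<in> L"
  shows "\<exists>y\<in>Cl h \<inter> ladder_points. a < y"
proof -
  have step: "\<exists>u'. u' \<in> L \<and> u < u' \<and> (\<forall>x\<le>u. h x < u')" if u: "u \<in> L" for u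
  proof -
    have "h x \<in> L" if "x \<in> {..u}" for x using that h down_le[OF u, of x] by auto
    then obtain b where b: "b \<in> L" "\<forall>x\<in>{..u}. h x < b"
      using image_bounded[OF atMost_card_less[OF u], of h] by blast
    obtain c where c: "c \<in> L" "u < c" using greater_ex[OF u] by blast
    have "max b c \<in> L" using b(1) c(1) by (simp add: max_def)
    moreover have "u < max b c" using c(2) by (simp add: less_max_iff_disj)
    moreover have "\<forall>x\<le>u. h x < max b c" using b(2) by (auto simp: less_max_iff_disj)
    ultimately show ?thesis by blast
  qed
  obtain z where z: "z 0 = a" "\<And>n. z n \<in> L \<and> z n < z (Suc n) \<and> (\<forall>x\<le>z n. h x < z (Suc n))"
  proof -
    \<comment> \<open>The choice principle leaves the first term open, so the start \<open>a\<close>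
      is made part of the invariant.\<close>
    have "\<exists>z. \<forall>n. (z n \<in> L \<and> (n = 0 \<longrightarrow> z n = a)) \<and> (z n < z (Suc n) \<and> (\<forall>x\<le>z n. h x < z (Suc n)))"
    proof (rule dependent_nat_choice)
      show "\<exists>x. x \<in> L \<and> (0 = (0 :: nat) \<longrightarrow> x = a)" using a by blast
      fix u and n :: nat assume "u \<in> L \<and> (n = 0 \<longrightarrow> u = a)"
      then show "\<exists>u'. (u' \<in> L \<and> (Suc n = 0 \<longrightarrow> u' = a)) \<and> (u < u' \<and> (\<forall>x\<le>u. h x < u'))"
        using step[of u] by simp
    qed
    then obtain z where "\<And>n. (z n \<in> L \<and> (n = 0 \<longrightarrow> z n = a)) \<and> (z n < z (Suc n) \<and> (\<forall>x\<le>z n. h x < z (Suc n)))"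
      by blast
    then show ?thesis using that[of z] by simp
  qed
  have "strict_mono z" using z(2) by (simp add: strict_mono_Suc_iff)
  moreover have "z n \<in> L" for n using z(2) by simp
  ultimately obtain y where y: "y \<in> ladder_points" "\<forall>n. z n < y" "\<forall>x<y. \<exists>n. x < z n"
    using strict_mono_limit[of z] by blast
  have "h x < y" if x: "x < y" for x
  proof -
    obtain n where "x < z n" using y(3) x by blast
    then have "h x < z (Suc n)" using z(2)[of n] by simp
    also have "z (Suc n) < y" using y(2) by simp
    finally show ?thesis .
  qed
  then have "y \<in> Cl h" using ladder_points_L[OF y(1)] unfolding Cl_def by blast
  moreover have "a < y" using y(2) z(1) by metis
  ultimately show ?thesis using y(1) by blast
qed

text \<open>Solovay's splitting of the points of countable cofinality into stationary sets, according to one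
  fixed entry of the ladder.\<close>

lemma stationary_splitting:
  "\<exists>n. |L| \<le>o |{a \<in> L. \<forall>h \<in> L \<rightarrow> L. \<exists>y \<in> Cl h \<inter> ladder_points. ladder y n = a}|"
proof -
  \<comment> \<open>Some fixed entry of the ladders is unbounded on every club. Otherwise the
    countably many counterexamples combine to one club and one bound \<open>b\<close>, and no ladder
    of a point of that club could pass \<open>b\<close>.\<close>
  have "\<exists>n. \<forall>c\<in>L. \<forall>h \<in> L \<rightarrow> L. \<exists>y \<in> Cl h \<inter> ladder_points. c \<le> ladder y n"
  proof (rule ccontr)
    assume "\<not> ?thesis"
    then have "\<forall>n. \<exists>c h. c \<in> L \<and> h \<in> L \<rightarrow> L \<and> (\<forall>y \<in> Cl h \<inter> ladder_points. ladder y n < c)"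
      by (metis not_le)
    then obtain c h where c: "\<And>n. c n \<in> L" and h: "\<And>n. h n \<in> L \<rightarrow> L"
      and less: "\<And>n y. y \<in> Cl (h n) \<inter> ladder_points \<Longrightarrow> ladder y n < c n" by metis
    obtain b where b: "b \<in> L" "\<forall>n. c n < b" using seq_bounded[of c] c by blast
    obtain g where g: "g \<in> L \<rightarrow> L" "\<forall>n\<in>UNIV. \<forall>x\<in>L. h n x < g x"
      using common_bound[OF nat_card_less, of UNIV h] h by blast
    obtain y where y: "y \<in> Cl g" "y \<in> ladder_points" "b < y" using Cl_unbounded[OF g(1) b(1)] by blast
    obtain n where n: "b < ladder y n"
      using ladder(2)[OF y(2)] y(3) unfolding order_lim_def by blast
    have "y \<in> Cl (h n)" using Cl_antimono[of "h n" g] g(2) y(1) by (meson UNIV_I less_imp_le subsetD)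
    then show False using less[of y n] y(2) b(2) n by (meson IntI less_asym less_trans)
  qed
  then obtain n where n: "\<And>c h. c \<in> L \<Longrightarrow> h \<in> L \<rightarrow> L \<Longrightarrow> \<exists>y \<in> Cl h \<inter> ladder_points. c \<le> ladder y n" by blast
  let ?A = "{a \<in> L. \<forall>h \<in> L \<rightarrow> L. \<exists>y \<in> Cl h \<inter> ladder_points. ladder y n = a}"
  \<comment> \<open>This is Fodor's argument: were no value from \<open>c\<close> on attained on
    every club, a diagonal intersection of the counterexamples would contradict the choice of
    \<open>n\<close>.\<close>
  have "\<exists>a\<in>?A. c \<le> a" if c: "c \<in> L" for c
  proof (rule ccontr)
    assume "\<not> ?thesis"
    then have "\<forall>a\<in>L. c \<le> a \<longrightarrow> (\<exists>h. h \<in> L \<rightarrow> L \<and> (\<forall>y \<in> Cl h \<inter> ladder_points. ladder y n \<noteq> a))" by blast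
    then obtain h where h: "\<And>a. a \<in> L \<Longrightarrow> c \<le> a \<Longrightarrow> h a \<in> L \<rightarrow> L"
      and neq: "\<And>a y. a \<in> L \<Longrightarrow> c \<le> a \<Longrightarrow> y \<in> Cl (h a) \<inter> ladder_points \<Longrightarrow> ladder y n \<noteq> a" by metis
    have "\<exists>b\<in>L. \<forall>a\<le>u. \<forall>x\<le>u. c \<le> a \<longrightarrow> h a x < b" if u: "u \<in> L" for u
    proof -
      have "|{..u} \<times> {..u}| <o |L|"
      proof (cases "finite {..u}")
        case True
        then have "|{..u} \<times> {..u}| <o natLeq" by (metis finite_SigmaI finite_iff_ordLess_natLeq)
        then show ?thesis using uncountable ordLess_transitive by blast
      next
        case False
        then have "|{..u} \<times> {..u}| =o |{..u}|" by (rule card_of_Times_same_infinite)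
        then show ?thesis using atMost_card_less[OF u] ordIso_ordLess_trans by blast
      qed
      \<comment> \<open>Nothing is known about \<open>h a\<close> for \<open>a < c\<close>; the
        default \<open>c\<close> keeps all values in \<open>L\<close>.\<close>
      from image_bounded[OF this, of "\<lambda>(a, x). if c \<le> a then h a x else c"]
      obtain b where "b \<in> L" "\<forall>p\<in>{..u} \<times> {..u}. (case p of (a, x) \<Rightarrow> if c \<le> a then h a x else c) < b"
        using h c down_le[OF u] by fastforce
      then show ?thesis by force
    qed
    \<comment> \<open>\<open>g\<close> encodes the diagonal intersection: a point \<open>y\<close>
      of \<open>Cl g\<close> lies in \<open>Cl (h a)\<close> whenever
      \<open>c \<le> a < y\<close>.\<close>
    then obtain g where g: "\<And>u. u \<in> L \<Longrightarrow> g u \<in> L"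
      "\<And>u a x. u \<in> L \<Longrightarrow> a \<le> u \<Longrightarrow> x \<le> u \<Longrightarrow> c \<le> a \<Longrightarrow> h a x < g u" by metis
    obtain y where y: "y \<in> Cl g" "y \<in> ladder_points" "c \<le> ladder y n"
      using n[OF c, of g] g(1) by blast
    let ?a = "ladder y n"
    have a: "?a \<in> L" "?a < y" using ladder_L ladder(1) y(2) by auto
    have "h ?a x < y" if x: "x < y" for x
    proof -
      have m: "max ?a x < y" "max ?a x \<in> L" using a x ladder_points_L[OF y(2)] down by (auto simp: max_def)
      have "h ?a x < g (max ?a x)" using g(2)[OF m(2)] y(3) by simp
      also have "g (max ?a x) < y" using y(1) m(1) unfolding Cl_def by blast
      finally show ?thesis .
    qed
    then have "y \<in> Cl (h ?a)" using ladder_points_L[OF y(2)] unfolding Cl_def by blast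
    then show False using neq[OF a(1) y(3)] y(2) by blast
  qed
  then have "|L| \<le>o |?A|" by (intro card_of_unbounded) auto
  then show ?thesis by blast
qed

end

section \<open>Guessing clubs\<close>

context regular_cardinal
begin

text \<open>The point \<open>\<tau>\<close> plays the role of the ordinal \<open>|M|\<^sup>+\<close>.\<close>

lemma successor_point_ex:
  assumes "infinite M" "cardSuc |M| <o |L|"
  shows "\<exists>\<tau>\<in>L. |M| <o |{..<\<tau>}| \<and> (\<forall>i<\<tau>. |{..<i}| \<le>o |M| ) \<and>
    (\<forall>X \<subseteq> {..<\<tau>}. |X| \<le>o |M| \<longrightarrow> (\<exists>j<\<tau>. \<forall>x\<in>X. x < j))"
proof -
  let ?F = "Field (cardSuc |M| )"
  have F: "|?F| =o cardSuc |M|"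
    by (simp add: card_of_Field_ordIso cardSuc_Card_order card_of_Card_order)
  have FL: "|?F| <o |L|" using F assms(2) by (rule ordIso_ordLess_trans)
  then obtain f where f: "inj_on f ?F" "f ` ?F \<subseteq> L" using ordLess_imp_ordLeq card_of_ordLeq by metis
  obtain b where b: "b \<in> L" "\<forall>x\<in>?F. f x < b" using image_bounded[OF FL, of f] f(2) by blast
  have "|M| <o cardSuc |M|" by (simp add: cardSuc_greater card_of_Card_order)
  also have "cardSuc |M| =o |?F|" using F by (rule ordIso_symmetric)
  also have "|?F| \<le>o |{..<b}|" by (rule card_of_ordLeqI[of f]) (use f(1) b(2) in auto)
  finally have Mb: "|M| <o |{..<b}|" .
  define \<tau> :: 'a where "\<tau> = (LEAST t. |M| <o |{..<t}| )"
  have \<tau>: "|M| <o |{..<\<tau>}|"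
    unfolding \<tau>_def using Mb by (rule LeastI)
  have "\<tau> \<le> b" unfolding \<tau>_def using Mb by (rule Least_le)
  then have \<tau>L: "\<tau> \<in> L" using b(1) down_le by blast
  have seg: "|{..<i}| \<le>o |M|" if "i < \<tau>" for i
  proof -
    have "\<not> |M| <o |{..<i}|" using that not_less_Least unfolding \<tau>_def by blast
    then show ?thesis by (simp add: not_ordLess_iff_ordLeq card_of_Well_order)
  qed
  have CM: "Cinfinite |M|" using assms(1) by (simp add: cinfinite_def Field_card_of card_of_card_order_on)
  \<comment> \<open>Successor cardinals are regular: otherwise at most \<open>|M|\<close> segments
    of size at most \<open>|M|\<close> would cover \<open>{..<\<tau>}\<close>.\<close>
  have "\<exists>j<\<tau>. \<forall>x\<in>X. x < j" if X: "X \<subseteq> {..<\<tau>}" "|X| \<le>o |M|" for X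
  proof (rule ccontr)
    assume "\<not> ?thesis"
    then have "{..<\<tau>} \<subseteq> (\<Union>x\<in>X. {..<x} \<union> {x})" by (fastforce simp: not_less)
    then have "|{..<\<tau>}| \<le>o |\<Union>x\<in>X. {..<x} \<union> {x}|" by (rule card_of_mono1)
    also have "|\<Union>x\<in>X. {..<x} \<union> {x}| \<le>o |M|"
    proof (rule UNION_Cinfinite_bound[OF X(2) ballI CM])
      fix x assume "x \<in> X"
      then have "|{..<x}| \<le>o |M|" using seg X(1) by blast
      moreover have "|{x}| \<le>o |M|" using assms(1) by (intro card_of_singl_ordLeq) auto
      ultimately show "|{..<x} \<union> {x}| \<le>o |M|" using CM by (rule Un_Cinfinite_bound)
    qed
    finally show False using \<tau> not_ordLess_ordLeq by blast
  qed
  then show ?thesis using \<tau> \<tau>L seg by blast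
qed

end

locale successor_point = regular_cardinal L for L :: "'a::wellorder set" +
  fixes M :: "'m set" and \<tau> :: 'a
  assumes infinite_M: "infinite M" and \<tau>_L: "\<tau> \<in> L"
    and M_less: "|M| <o |{..<\<tau>}|"
    and below_\<tau>: "i < \<tau> \<Longrightarrow> |{..<i}| \<le>o |M|"
    and bounded_\<tau>: "X \<subseteq> {..<\<tau>} \<Longrightarrow> |X| \<le>o |M| \<Longrightarrow> \<exists>j<\<tau>. \<forall>x\<in>X. x < j"
begin

definition cofinal_seq :: "'a \<Rightarrow> ('a \<Rightarrow> 'a) \<Rightarrow> bool" where
  "cofinal_seq \<delta> d \<longleftrightarrow> (\<forall>j<\<tau>. \<forall>i<j. d i < d j) \<and> (\<forall>j<\<tau>. d j < \<delta>) \<and> (\<forall>z<\<delta>. \<exists>j<\<tau>. z < d j)"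

definition club_seq :: "'a \<Rightarrow> 'a \<Rightarrow> 'a" where
  "club_seq \<delta> = (SOME d. cofinal_seq \<delta> d)"

text \<open>This closes \<open>club_seq \<delta>\<close> at limits: at a limit index it is the
  supremum of the earlier entries, so for \<delta> of cofinality \<tau> the points below \<tau> form
  a club of \<delta>.\<close>

definition club_point :: "'a \<Rightarrow> 'a \<Rightarrow> 'a" where
  "club_point \<delta> i = (LEAST z. \<forall>k<i. club_seq \<delta> k < z)"

text \<open>Before each stage fewer than \<lambda> points have been chosen, so the next one fits
  above them; since \<tau> itself is below \<lambda>, the supremum \<delta> stays in
  \<open>L\<close>.\<close>

lemma cofinal_seq_in_Cl:
  assumes h: "h \<in> L \<rightarrow> L"
  shows "\<exists>\<delta>\<in>L. \<exists>x. cofinal_seq \<delta> x \<and> (\<forall>i<\<tau>. x i \<in> Cl h)"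
proof -
  have "\<exists>x. \<forall>i. i < \<tau> \<longrightarrow> x i \<in> Cl h \<and> (\<forall>k<i. x k < x i)"
  proof (rule dependent_wf_choice[OF wf, where P = "\<lambda>x i r. i < \<tau> \<longrightarrow> r \<in> Cl h \<and> (\<forall>k<i. x k < r)"])
    fix f g :: "'a \<Rightarrow> 'a" and x r assume "\<And>z. (z, x) \<in> {(x, y). x < y} \<Longrightarrow> f z = g z"
    then show "(x < \<tau> \<longrightarrow> r \<in> Cl h \<and> (\<forall>k<x. f k < r)) = (x < \<tau> \<longrightarrow> r \<in> Cl h \<and> (\<forall>k<x. g k < r))"
      by simp
  next
    fix i x assume IH: "\<And>k. (k, i) \<in> {(x, y). x < y} \<Longrightarrow> k < \<tau> \<longrightarrow> x k \<in> Cl h \<and> (\<forall>j<k. x j < x k)"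
    show "\<exists>r. i < \<tau> \<longrightarrow> r \<in> Cl h \<and> (\<forall>k<i. x k < r)"
    proof (cases "i < \<tau>")
      case True
      then have "|{..<i}| <o |L|" using segment down \<tau>_L by blast
      moreover have "x k \<in> L" if "k \<in> {..<i}" for k
        using IH[of k] that True unfolding Cl_def by auto
      ultimately obtain b where b: "b \<in> L" "\<forall>k\<in>{..<i}. x k < b"
        using image_bounded[of "{..<i}" x] by blast
      obtain y where "y \<in> Cl h" "b < y" using Cl_unbounded[OF h b(1)] by blast
      then have "y \<in> Cl h \<and> (\<forall>k<i. x k < y)" using b(2) by (meson lessThan_iff less_trans)
      then show ?thesis by blast
    qed blast
  qed
  then obtain x where x: "\<And>i. i < \<tau> \<Longrightarrow> x i \<in> Cl h" "\<And>i k. i < \<tau> \<Longrightarrow> k < i \<Longrightarrow> x k < x i" by blast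
  have "x i \<in> L" if "i \<in> {..<\<tau>}" for i using x(1) that unfolding Cl_def by auto
  then obtain b where b: "b \<in> L" "\<forall>i<\<tau>. x i < b"
    using image_bounded[OF segment[OF \<tau>_L], of x] by auto
  define \<delta> where "\<delta> = (LEAST u. \<forall>i<\<tau>. x i < u)"
  have \<delta>: "\<forall>i<\<tau>. x i < \<delta>" unfolding \<delta>_def using b(2) by (rule LeastI)
  have "\<delta> \<le> b" unfolding \<delta>_def using b(2) by (rule Least_le)
  then have "\<delta> \<in> L" using b(1) down_le by blast
  moreover have "\<exists>j<\<tau>. z < x j" if z: "z < \<delta>" for z
  proof -
    have "\<not> (\<forall>i<\<tau>. x i < z)" using z not_less_Least unfolding \<delta>_def by blast
    then obtain i where i: "i < \<tau>" "z \<le> x i" by (auto simp: not_less)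
    have "|{i}| \<le>o |M|" using infinite_M by (intro card_of_singl_ordLeq) auto
    then obtain j where "j < \<tau>" "i < j" using bounded_\<tau>[of "{i}"] i(1) by auto
    then show ?thesis using x(2)[of j i] i(2) by (meson le_less_trans)
  qed
  ultimately show ?thesis using \<delta> x unfolding cofinal_seq_def by blast
qed

text \<open>The two sequences interleave: \<open>club_point \<delta> i \<le> club_seq \<delta> i <
  club_point \<delta> j\<close>.\<close>

lemma club_point_strict_mono:
  assumes "cofinal_seq \<delta> (club_seq \<delta>)" "i < j" "j < \<tau>"
  shows "club_point \<delta> i < club_point \<delta> j"
proof -
  have mono: "\<And>i j. i < j \<Longrightarrow> j < \<tau> \<Longrightarrow> club_seq \<delta> i < club_seq \<delta> j"
    and less: "\<And>j. j < \<tau> \<Longrightarrow> club_seq \<delta> j < \<delta>"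
    using assms(1) unfolding cofinal_seq_def by blast+
  have "club_point \<delta> i \<le> club_seq \<delta> i"
    unfolding club_point_def using mono assms(2,3) by (intro Least_le) (meson less_trans)
  also have "\<forall>k<j. club_seq \<delta> k < club_point \<delta> j"
    unfolding club_point_def by (rule LeastI[of _ \<delta>]) (use less assms(3) in \<open>meson less_trans\<close>)
  then have "club_seq \<delta> i < club_point \<delta> j" using assms(2) by blast
  finally show ?thesis .
qed

text \<open>If \<open>Cl h\<close> is cofinal in \<delta>, it alternates with
  \<open>club_seq \<delta>\<close>, and the limit of \<omega> alternations is a ladder point common
  to \<open>Cl h\<close> and the club of \<delta>. Such indices are unbounded in \<tau>, so there
  are more than \<open>|M|\<close> of them.\<close>

lemma club_points_large:
  assumes h: "h \<in> L \<rightarrow> L"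
  shows "\<exists>\<delta>\<in>L. \<exists>j<\<tau>. |M| \<le>o |club_point \<delta> ` {..<j} \<inter> Cl h \<inter> ladder_points|"
proof -
  obtain \<delta> x where \<delta>: "\<delta> \<in> L" and x: "cofinal_seq \<delta> x" "\<And>i. i < \<tau> \<Longrightarrow> x i \<in> Cl h"
    using cofinal_seq_in_Cl[OF h] by blast
  let ?d = "club_seq \<delta>"
  have cd: "cofinal_seq \<delta> ?d" unfolding club_seq_def using x(1) by (rule someI[where P = "cofinal_seq \<delta>"])
  have mono: "\<And>i j. i < j \<Longrightarrow> j < \<tau> \<Longrightarrow> ?d i < ?d j" and less: "\<And>j. j < \<tau> \<Longrightarrow> ?d j < \<delta>"
    and cof: "\<And>z. z < \<delta> \<Longrightarrow> \<exists>j<\<tau>. z < ?d j"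
    using cd unfolding cofinal_seq_def by blast+
  have step: "\<exists>i'. i' < \<tau> \<and> i < i' \<and> (\<exists>y\<in>Cl h. ?d i < y \<and> y < ?d i')" if i: "i < \<tau>" for i
  proof -
    obtain k where k: "k < \<tau>" "?d i < x k" using x(1) less[OF i] unfolding cofinal_seq_def by blast
    have "x k < \<delta>" using x(1) k(1) unfolding cofinal_seq_def by blast
    then obtain j where j: "j < \<tau>" "x k < ?d j" using cof by blast
    have "i < j"
    proof (rule ccontr)
      assume "\<not> i < j"
      then have "?d j \<le> ?d i" using mono[of j i] i by (cases i j rule: linorder_cases) auto
      then show False using k(2) j(2) by simp
    qed
    then show ?thesis using x(2)[OF k(1)] k(2) j by blast
  qed
  have unb: "\<exists>i<\<tau>. i0 < i \<and> club_point \<delta> i \<in> Cl h \<inter> ladder_points" if i0: "i0 < \<tau>" for i0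
  proof -
    have "\<exists>s. \<forall>n. (s n < \<tau> \<and> (n = 0 \<longrightarrow> s n = i0)) \<and>
        (s n < s (Suc n) \<and> (\<exists>y\<in>Cl h. ?d (s n) < y \<and> y < ?d (s (Suc n))))"
    proof (rule dependent_nat_choice)
      show "\<exists>i. i < \<tau> \<and> (0 = (0 :: nat) \<longrightarrow> i = i0)" using i0 by blast
      fix i and n :: nat assume "i < \<tau> \<and> (n = 0 \<longrightarrow> i = i0)"
      then show "\<exists>i'. (i' < \<tau> \<and> (Suc n = 0 \<longrightarrow> i' = i0)) \<and> (i < i' \<and> (\<exists>y\<in>Cl h. ?d i < y \<and> y < ?d i'))"
        using step[of i] by simp
    qed
    then obtain s where s: "\<And>n. s n < \<tau>" "s 0 = i0" "\<And>n. s n < s (Suc n)"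
      and between: "\<And>n. \<exists>y\<in>Cl h. ?d (s n) < y \<and> y < ?d (s (Suc n))" by blast
    have "strict_mono (\<lambda>n. ?d (s n))" using mono s(1,3) by (simp add: strict_mono_Suc_iff)
    moreover have "?d (s n) \<in> L" for n using less[OF s(1)] \<delta> down by blast
    ultimately obtain y where y: "y \<in> ladder_points" "\<forall>n. ?d (s n) < y" "\<forall>z<y. \<exists>n. z < ?d (s n)"
      using strict_mono_limit[of "\<lambda>n. ?d (s n)"] by blast
    have "|range s| \<le>o |M|"
      using card_of_image infinite_M infinite_iff_card_of_nat ordLeq_transitive by blast
    then obtain j where j: "j < \<tau>" "\<forall>n. s n < j" using bounded_\<tau>[of "range s"] s(1) by auto
    \<comment> \<open>At the supremum \<open>w\<close> of the indices \<open>s n\<close>,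
      \<open>club_point\<close> takes the supremum \<open>y\<close> of the values.\<close>
    define w where "w = (LEAST j. \<forall>n. s n < j)"
    have w: "\<forall>n. s n < w" unfolding w_def using j(2) by (rule LeastI)
    have "w \<le> j" unfolding w_def using j(2) by (rule Least_le)
    then have w\<tau>: "w < \<tau>" using j(1) by simp
    have below_w: "\<exists>n. k \<le> s n" if "k < w" for k
      using that not_less_Least[of k "\<lambda>j. \<forall>n. s n < j"] unfolding w_def[symmetric] by (auto simp: not_less)
    have "club_point \<delta> w = y" unfolding club_point_def
    proof (rule Least_equality)
      show "\<forall>k<w. ?d k < y"
      proof (intro allI impI)
        fix k assume "k < w"
        then obtain n where n: "k \<le> s n" using below_w by blast
        have "?d k \<le> ?d (s n)" using n mono[of k "s n"] s(1) by (cases "k = s n") (auto simp: less_le)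
        then show "?d k < y" using y(2) by (meson le_less_trans)
      qed
    next
      fix z assume z: "\<forall>k<w. ?d k < z"
      show "y \<le> z"
      proof (rule ccontr)
        assume "\<not> y \<le> z"
        then have "z < y" by simp
        then obtain n where "z < ?d (s n)" using y(3) by blast
        then show False using z w by (meson less_asym)
      qed
    qed
    moreover have "y \<in> Cl h"
    proof -
      have "h u < y" if u: "u < y" for u
      proof -
        obtain n where n: "u < ?d (s n)" using y(3) u by blast
        obtain v where v: "v \<in> Cl h" "?d (s n) < v" "v < ?d (s (Suc n))" using between by blast
        have "u < v" using n v(2) by simp
        then have "h u < v" using v(1) unfolding Cl_def by blast
        also have "v < ?d (s (Suc n))" by (rule v(3))
        also have "?d (s (Suc n)) < y" using y(2) by blast
        finally show ?thesis .
      qed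
      then show ?thesis using ladder_points_L[OF y(1)] unfolding Cl_def by blast
    qed
    moreover have "i0 < w" using w s(2) by metis
    ultimately show ?thesis using w\<tau> y(1) by blast
  qed
  let ?P = "{i. i < \<tau> \<and> club_point \<delta> i \<in> Cl h \<inter> ladder_points}"
  have "\<not> |?P| \<le>o |M|"
  proof
    assume "|?P| \<le>o |M|"
    moreover have "?P \<subseteq> {..<\<tau>}" by auto
    ultimately obtain j where j: "j < \<tau>" "\<forall>i\<in>?P. i < j" using bounded_\<tau>[of ?P] by blast
    obtain i where "i < \<tau>" "j < i" "club_point \<delta> i \<in> Cl h \<inter> ladder_points" using unb[OF j(1)] by blast
    then have "i < j" using j(2) by blast
    then show False using \<open>j < i\<close> by simp
  qed
  then have "|M| <o |?P|" by (simp only: not_ordLeq_iff_ordLess card_of_Well_order)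
  then have "|M| \<le>o |?P|" by (rule ordLess_imp_ordLeq)
  \<comment> \<open>Only \<open>|M|\<close> of these indices are kept, so that by regularity of
    \<tau> they lie below some \<open>j < \<tau>\<close>.\<close>
  then obtain f where f: "inj_on f M" "f ` M \<subseteq> ?P" unfolding card_of_ordLeq[symmetric] by blast
  have "f ` M \<subseteq> {..<\<tau>}" using f(2) by auto
  then obtain j where j: "j < \<tau>" "\<forall>x\<in>f ` M. x < j" using bounded_\<tau>[OF _ card_of_image] by blast
  have "inj_on (club_point \<delta>) {..<\<tau>}"
  proof (rule inj_onI)
    fix a b assume "a \<in> {..<\<tau>}" "b \<in> {..<\<tau>}" "club_point \<delta> a = club_point \<delta> b"
    then show "a = b"
      using club_point_strict_mono[OF cd, of a b] club_point_strict_mono[OF cd, of b a]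
      by (cases a b rule: linorder_cases) auto
  qed
  then have "inj_on (club_point \<delta> \<circ> f) M"
    using f(1) \<open>f ` M \<subseteq> {..<\<tau>}\<close> by (meson comp_inj_on inj_on_subset)
  moreover have "(club_point \<delta> \<circ> f) ` M \<subseteq> club_point \<delta> ` {..<j} \<inter> Cl h \<inter> ladder_points"
    using f(2) j(2) by fastforce
  ultimately have "|M| \<le>o |club_point \<delta> ` {..<j} \<inter> Cl h \<inter> ladder_points|"
    by (intro card_of_ordLeqI[of "club_point \<delta> \<circ> f"]) blast+
  then show ?thesis using \<delta> j(1) by blast
qed

text \<open>Cutting the club of \<delta> off at \<open>j < \<tau>\<close> leaves at most
  \<open>|M|\<close> points, fewer than the number \<tau> of possible refinements.\<close>

definition guesses :: "('a \<Rightarrow> 'a) \<Rightarrow> ('a \<Rightarrow> 'a) \<Rightarrow> bool" where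
  "guesses g h \<longleftrightarrow> (\<exists>\<delta>\<in>L. \<exists>j<\<tau>. |M| \<le>o |club_point \<delta> ` {..<j} \<inter> Cl g \<inter> ladder_points| \<and>
    club_point \<delta> ` {..<j} \<inter> Cl g \<inter> ladder_points \<subseteq> Cl h)"

text \<open>Otherwise one could iterate \<open>\<tau>\<close> times, and the trace of the clubs on one fixed set of at most
  \<open>|M|\<close> points would shrink strictly at every step.\<close>

lemma guessing_stabilizes: "\<exists>g\<in>L \<rightarrow> L. \<forall>h\<in>L \<rightarrow> L. guesses g h"
proof (rule ccontr)
  assume neg: "\<not> ?thesis"
  have next_ex: "\<exists>r\<in>L \<rightarrow> L. (\<forall>x\<in>L. g x \<le> r x) \<and> \<not> guesses g r" if g: "g \<in> L \<rightarrow> L" for g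
  proof -
    obtain h where h: "h \<in> L \<rightarrow> L" "\<not> guesses g h" using neg g by blast
    let ?r = "\<lambda>x. max (g x) (h x)"
    have "?r \<in> L \<rightarrow> L" using g h(1) by (auto simp: max_def)
    moreover have "Cl ?r \<subseteq> Cl h" by (rule Cl_antimono) simp
    then have "\<not> guesses g ?r" using h(2) unfolding guesses_def by blast
    ultimately show ?thesis by (intro bexI[of _ ?r]) auto
  qed
  \<comment> \<open>At stage \<open>j\<close> an intermediate \<open>g\<close> dominates all earlier
    \<open>F i\<close>, which handles limit stages; \<open>F j\<close> then lies above
    \<open>g\<close> and has a club that \<open>g\<close> fails to guess.\<close>
  let ?Q = "\<lambda>F j r. j < \<tau> \<longrightarrow> r \<in> L \<rightarrow> L \<and>
    (\<exists>g\<in>L \<rightarrow> L. (\<forall>i<j. \<forall>x\<in>L. F i x \<le> g x) \<and> (\<forall>x\<in>L. g x \<le> r x) \<and> \<not> guesses g r)"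
  have "\<exists>F. \<forall>j. ?Q F j (F j)"
  proof (rule dependent_wf_choice[OF wf, where P = ?Q])
    fix F G :: "'a \<Rightarrow> 'a \<Rightarrow> 'a" and j r
    assume "\<And>z. (z, j) \<in> {(x, y). x < y} \<Longrightarrow> F z = G z"
    then have "(\<forall>i<j. \<forall>x\<in>L. F i x \<le> g x) \<longleftrightarrow> (\<forall>i<j. \<forall>x\<in>L. G i x \<le> g x)" for g by simp
    then show "?Q F j r = ?Q G j r" by presburger
  next
    fix j and F :: "'a \<Rightarrow> 'a \<Rightarrow> 'a"
    assume IH: "\<And>i. (i, j) \<in> {(x, y). x < y} \<Longrightarrow> ?Q F i (F i)"
    show "\<exists>r. ?Q F j r"
    proof (cases "j < \<tau>")
      case True
      then have "|{..<j}| <o |L|" using segment down \<tau>_L by blast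
      moreover have "F i \<in> L \<rightarrow> L" if i: "i \<in> {..<j}" for i
      proof -
        have "i < j" "i < \<tau>" using i True by auto
        then show ?thesis using IH[of i] by blast
      qed
      ultimately obtain g where g: "g \<in> L \<rightarrow> L" "\<forall>i\<in>{..<j}. \<forall>x\<in>L. F i x < g x"
        using common_bound[of "{..<j}" F] by blast
      obtain r where "r \<in> L \<rightarrow> L" "\<forall>x\<in>L. g x \<le> r x" "\<not> guesses g r" using next_ex[OF g(1)] by blast
      moreover have "\<forall>i<j. \<forall>x\<in>L. F i x \<le> g x" using g(2) by (simp add: less_imp_le)
      ultimately show ?thesis using g(1) by blast
    qed blast
  qed
  then obtain F where F: "\<And>j. ?Q F j (F j)" by blast
  have "\<forall>j. \<exists>g. j < \<tau> \<longrightarrow> g \<in> L \<rightarrow> L \<and> (\<forall>i<j. \<forall>x\<in>L. F i x \<le> g x) \<and> (\<forall>x\<in>L. g x \<le> F j x) \<and> \<not> guesses g (F j)"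
    using F by blast
  then obtain g where g: "\<And>j. j < \<tau> \<Longrightarrow> g j \<in> L \<rightarrow> L"
    and Fg: "\<And>j i x. j < \<tau> \<Longrightarrow> i < j \<Longrightarrow> x \<in> L \<Longrightarrow> F i x \<le> g j x"
    and gF: "\<And>j x. j < \<tau> \<Longrightarrow> x \<in> L \<Longrightarrow> g j x \<le> F j x"
    and bad: "\<And>j. j < \<tau> \<Longrightarrow> \<not> guesses (g j) (F j)" by metis
  have "F j \<in> L \<rightarrow> L" if "j \<in> {..<\<tau>}" for j using F that by blast
  then obtain G where G: "G \<in> L \<rightarrow> L" "\<forall>j\<in>{..<\<tau>}. \<forall>x\<in>L. F j x < G x"
    using common_bound[OF segment[OF \<tau>_L], of F] by blast
  \<comment> \<open>\<open>Cl G\<close> is contained in all clubs of the iteration, so this one pair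
    gives a large trace at every stage.\<close>
  obtain \<delta> j where \<delta>: "\<delta> \<in> L" "j < \<tau>" "|M| \<le>o |club_point \<delta> ` {..<j} \<inter> Cl G \<inter> ladder_points|"
    using club_points_large[OF G(1)] by blast
  let ?A = "club_point \<delta> ` {..<j}"
  have "\<exists>a. a \<in> ?A \<inter> Cl (g i) \<inter> ladder_points \<and> a \<notin> Cl (F i)" if i: "i < \<tau>" for i
  proof -
    have "Cl G \<subseteq> Cl (g i)"
    proof (rule Cl_antimono)
      fix x assume x: "x \<in> L"
      have "g i x \<le> F i x" using gF i x by blast
      also have "F i x \<le> G x" using G(2) i x by (simp add: less_imp_le)
      finally show "g i x \<le> G x" .
    qed
    then have "|?A \<inter> Cl G \<inter> ladder_points| \<le>o |?A \<inter> Cl (g i) \<inter> ladder_points|"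
      by (intro card_of_mono1) blast
    then have "|M| \<le>o |?A \<inter> Cl (g i) \<inter> ladder_points|" using \<delta>(3) ordLeq_transitive by blast
    then show ?thesis using bad[OF i] \<delta>(1,2) unfolding guesses_def by blast
  qed
  then obtain a where a: "\<And>i. i < \<tau> \<Longrightarrow> a i \<in> ?A \<inter> Cl (g i) \<inter> ladder_points \<and> a i \<notin> Cl (F i)" by metis
  \<comment> \<open>The point \<open>a i\<close> is lost at stage \<open>i\<close>, while
    \<open>a k\<close> has survived all stages before \<open>k\<close>.\<close>
  have neq: "a i \<noteq> a k" if ik: "i < k" "k < \<tau>" for i k
  proof -
    have "Cl (g k) \<subseteq> Cl (F i)" by (rule Cl_antimono) (rule Fg[OF ik(2,1)])
    then show ?thesis using a[of i] a[of k] ik by auto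
  qed
  have "inj_on a {..<\<tau>}"
  proof (rule inj_onI)
    fix i k assume "i \<in> {..<\<tau>}" "k \<in> {..<\<tau>}" "a i = a k"
    then show "i = k" using neq[of i k] neq[of k i] by (cases i k rule: linorder_cases) auto
  qed
  then have "|{..<\<tau>}| \<le>o |?A|" by (rule card_of_ordLeqI) (use a in auto)
  also have "|?A| \<le>o |{..<j}|" by (rule card_of_image)
  also have "|{..<j}| \<le>o |M|" by (rule below_\<tau>[OF \<delta>(2)])
  finally show False using M_less not_ordLess_ordLeq by blast
qed

text \<open>There is one trace for each pair \<open>(\<delta>, j)\<close>, hence at most \<lambda>
  in all. A large trace has exactly \<open>|M|\<close> points and is listed by \<open>M\<close>
  itself, so that a sequence in \<open>M\<close> names a sequence of points in every member.\<close>

lemma guessing_family: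
  "\<exists>C :: ('m \<Rightarrow> 'a) set. |C| \<le>o |L| \<and> (\<forall>c\<in>C. inj_on c M \<and> c ` M \<subseteq> ladder_points) \<and>
    (\<forall>h\<in>L \<rightarrow> L. \<exists>c\<in>C. c ` M \<subseteq> Cl h)"
proof -
  obtain g where g: "\<And>h. h \<in> L \<rightarrow> L \<Longrightarrow> guesses g h" using guessing_stabilizes by blast
  define B where "B = (\<lambda>(\<delta>, j). club_point \<delta> ` {..<j} \<inter> Cl g \<inter> ladder_points)"
  define enum where "enum p = (SOME c. bij_betw c M (B p))" for p
  define C where "C = enum ` {p \<in> L \<times> {..<\<tau>}. |M| \<le>o |B p|}"
  have enum: "bij_betw (enum p) M (B p)" if p: "p \<in> L \<times> {..<\<tau>}" "|M| \<le>o |B p|" for p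
  proof -
    obtain \<delta> j where \<delta>: "p = (\<delta>, j)" "j < \<tau>" using p(1) by auto
    have "|B p| \<le>o |club_point \<delta> ` {..<j}|" unfolding \<delta>(1) B_def prod.case by (intro card_of_mono1) blast
    also have "|club_point \<delta> ` {..<j}| \<le>o |{..<j}|" by (rule card_of_image)
    also have "|{..<j}| \<le>o |M|" by (rule below_\<tau>[OF \<delta>(2)])
    finally have "|M| =o |B p|" using p(2) ordIso_iff_ordLeq by blast
    then have "\<exists>c. bij_betw c M (B p)" using card_of_ordIso by blast
    then show ?thesis unfolding enum_def by (rule someI_ex)
  qed
  have "|C| \<le>o |{p \<in> L \<times> {..<\<tau>}. |M| \<le>o |B p| }|" unfolding C_def by (rule card_of_image)
  also have "|{p \<in> L \<times> {..<\<tau>}. |M| \<le>o |B p| }| \<le>o |L \<times> {..<\<tau>}|" by (intro card_of_mono1) blast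
  also have "|L \<times> {..<\<tau>}| \<le>o |L|"
    using Cinfinite_L segment[OF \<tau>_L]
    by (intro card_of_Times_bound ordLeq_refl) (auto intro: ordLess_imp_ordLeq)
  finally have "|C| \<le>o |L|" .
  moreover have "inj_on c M \<and> c ` M \<subseteq> ladder_points" if c: "c \<in> C" for c
  proof -
    obtain p where p: "p \<in> L \<times> {..<\<tau>}" "|M| \<le>o |B p|" "c = enum p" using c unfolding C_def by blast
    have "B p \<subseteq> ladder_points" unfolding B_def by (cases p) auto
    then show ?thesis using enum[OF p(1,2)] p(3) by (simp add: bij_betw_def)
  qed
  moreover have "\<exists>c\<in>C. c ` M \<subseteq> Cl h" if h: "h \<in> L \<rightarrow> L" for h
  proof -
    obtain \<delta> j where p: "\<delta> \<in> L" "j < \<tau>" "|M| \<le>o |B (\<delta>, j)|" "B (\<delta>, j) \<subseteq> Cl h"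
      using g[OF h] unfolding guesses_def B_def prod.case by blast
    have "enum (\<delta>, j) \<in> C" unfolding C_def using p by blast
    moreover have "enum (\<delta>, j) ` M = B (\<delta>, j)" using enum[of "(\<delta>, j)"] p by (simp add: bij_betw_def)
    ultimately show ?thesis using p(4) by metis
  qed
  ultimately show ?thesis by blast
qed

end

context regular_cardinal
begin

lemma guessing:
  assumes "infinite (M :: 'm set)" "cardSuc |M| <o |L|"
  shows "\<exists>C :: ('m \<Rightarrow> 'a) set. |C| \<le>o |L| \<and> (\<forall>c\<in>C. inj_on c M \<and> c ` M \<subseteq> ladder_points) \<and>
    (\<forall>h\<in>L \<rightarrow> L. \<exists>c\<in>C. c ` M \<subseteq> Cl h)"
proof -
  obtain \<tau> where \<tau>: "\<tau> \<in> L" "|M| <o |{..<\<tau>}|" "\<forall>i<\<tau>. |{..<i}| \<le>o |M|"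
    "\<forall>X \<subseteq> {..<\<tau>}. |X| \<le>o |M| \<longrightarrow> (\<exists>j<\<tau>. \<forall>x\<in>X. x < j)"
    using successor_point_ex[OF assms] by blast
  interpret successor_point L M \<tau>
    by unfold_locales (use assms(1) \<tau> in blast)+
  show ?thesis by (rule guessing_family)
qed

end

section \<open>Sequences of points of countable cofinality\<close>

datatype 'a tree_vertex = Node "'a list" | Apex "nat \<Rightarrow> 'a" | Rim "nat \<Rightarrow> 'a" nat

definition branch :: "(nat \<Rightarrow> 'a) \<Rightarrow> nat \<Rightarrow> 'a tree_vertex" where
  "branch z j = Node (map z [0..<j])"

text \<open>The neighbourhood of \<open>Apex t\<close> is a ray, and its vertex of index \<open>2 * n\<close> is joined to the branch
  of the tree of finite sequences which converges to \<open>t n\<close>.  Only even indices are used, since otherwise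
  two consecutive rim vertices could be adjacent to a common node.\<close>

definition tree_fans :: "'a set \<Rightarrow> ('a \<Rightarrow> nat \<Rightarrow> 'a) \<Rightarrow> (nat \<Rightarrow> 'a) set \<Rightarrow> 'a tree_vertex graph" where
  "tree_fans L lad T =
    (Node ` lists L \<union> (Apex ` T \<union> case_prod Rim ` (T \<times> UNIV)),
     {{Node s, Node (s @ [x])} |s x. s \<in> lists L \<and> x \<in> L} \<union> {{Apex t, Rim t n} |t n. t \<in> T} \<union>
     {{Rim t n, Rim t (Suc n)} |t n. t \<in> T} \<union>
     {{Rim t (2 * n), branch (lad (t n)) j} |t n j. t \<in> T})"

lemma branch_eq_iff: "branch z i = branch z j \<longleftrightarrow> i = j"
  unfolding branch_def by (metis length_map length_upt minus_nat.diff_0 tree_vertex.inject(1))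

lemma branch_in_tree_fans: "(\<And>j. z j \<in> L) \<Longrightarrow> branch z n \<in> verts (tree_fans L lad T)"
  by (simp add: tree_fans_def branch_def image_iff) (auto intro!: bexI[of _ "map z [0..<n]"])

lemma tree_fans_edges:
  "{Apex t, u} \<in> edges (tree_fans L lad T) \<longleftrightarrow> t \<in> T \<and> u \<in> range (Rim t)"
  "{Rim t m, Apex t'} \<in> edges (tree_fans L lad T) \<longleftrightarrow> t = t' \<and> t \<in> T"
  "{Rim t m, Rim t' n} \<in> edges (tree_fans L lad T) \<longleftrightarrow> t = t' \<and> t \<in> T \<and> (n = Suc m \<or> m = Suc n)"
  "{Rim t m, Node s} \<in> edges (tree_fans L lad T) \<longleftrightarrow>
    t \<in> T \<and> (\<exists>n j. m = 2 * n \<and> Node s = branch (lad (t n)) j)"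
  "{Node s, Rim t m} \<in> edges (tree_fans L lad T) \<longleftrightarrow>
    t \<in> T \<and> (\<exists>n j. m = 2 * n \<and> Node s = branch (lad (t n)) j)"
  "{Node s, Apex t} \<notin> edges (tree_fans L lad T)"
  "{Node s, Node s'} \<in> edges (tree_fans L lad T) \<Longrightarrow> (\<exists>x. s' = s @ [x]) \<or> (\<exists>x. s = s' @ [x])"
  by (auto simp: tree_fans_def branch_def doubleton_eq_iff image_iff)

text \<open>Past the parent of \<open>s\<close>, such a ray would alternate between children of
  \<open>s\<close> and rim vertices of even index. A rim vertex is joined to a single branch, which
  contains at most one child of \<open>s\<close>, so a child would be repeated.\<close>

lemma tree_fans_no_ray_Node:
  "\<not> is_ray (induced (tree_fans L lad T) (neighbours (tree_fans L lad T) (Node s))) r"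
proof
  let ?E = "edges (tree_fans L lad T)"
  assume "is_ray (induced (tree_fans L lad T) (neighbours (tree_fans L lad T) (Node s))) r"
  then have inj: "inj r" and nbh: "\<And>n. {Node s, r n} \<in> ?E" and edge: "\<And>n. {r n, r (Suc n)} \<in> ?E"
    by (auto simp: is_ray_nbh)
  \<comment> \<open>The parent is met at most once. For the empty list \<open>butlast\<close>
    returns the list itself, and the bound still exists.\<close>
  obtain N where N: "\<And>n. n \<ge> N \<Longrightarrow> r n \<noteq> Node (butlast s)"
  proof (cases "\<exists>i. r i = Node (butlast s)")
    case True
    then obtain i where "r i = Node (butlast s)" by blast
    then have "r n \<noteq> Node (butlast s)" if "n \<ge> Suc i" for n using that inj_eq[OF inj, of n i] by auto
    then show ?thesis using that by blast
  qed (use that in blast)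
  have cases: "(\<exists>x. r n = Node (s @ [x])) \<or> (\<exists>t m. r n = Rim t (2 * m))" if "n \<ge> N" for n
  proof (cases "r n")
    case (Node s')
    then have "(\<exists>x. s' = s @ [x]) \<or> (\<exists>x. s = s' @ [x])" using nbh[of n] by (auto dest: tree_fans_edges(7))
    then show ?thesis using N[OF that] Node by auto
  next
    case (Apex t)
    then show ?thesis using nbh[of n] by (simp add: tree_fans_edges(6))
  next
    case (Rim t m)
    then show ?thesis using nbh[of n] by (auto simp: tree_fans_edges(5))
  qed
  have rim_next: "\<exists>x. r (Suc n) = Node (s @ [x])" if n: "n \<ge> N" "r n = Rim t (2 * m)" for n t m
  proof (rule ccontr)
    assume "\<not> ?thesis"
    then obtain t' m' where "r (Suc n) = Rim t' (2 * m')" using cases[of "Suc n"] n(1) by auto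
    then have "2 * m' = Suc (2 * m) \<or> 2 * m = Suc (2 * m')"
      using edge[of n] n(2) by (simp add: tree_fans_edges(3))
    then show False by presburger
  qed
  have node_next: "\<exists>t m. r (Suc n) = Rim t (2 * m)" if n: "n \<ge> N" "r n = Node (s @ [x])" for n x
  proof (rule ccontr)
    assume "\<not> ?thesis"
    then obtain y where "r (Suc n) = Node (s @ [y])" using cases[of "Suc n"] n(1) by auto
    then show False using edge[of n] n(2) by (auto dest: tree_fans_edges(7))
  qed
  obtain n x where n: "n \<ge> N" "r n = Node (s @ [x])"
    using cases[of N] rim_next[of N] by (metis le_Suc_eq order_refl)
  obtain t m where rim: "r (Suc n) = Rim t (2 * m)" using node_next[OF n] by blast
  obtain y where y: "r (Suc (Suc n)) = Node (s @ [y])" using rim_next[of "Suc n"] n(1) rim by auto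
  have "z = lad (t m) (length s)" if z: "{Rim t (2 * m), Node (s @ [z])} \<in> ?E" for z
  proof -
    obtain j where j: "s @ [z] = map (lad (t m)) [0..<j]"
      using z by (auto simp: tree_fans_edges(4) branch_def)
    then have "length (s @ [z]) = j" by simp
    then show ?thesis using j by (metis length_append_singleton lessI nth_append_length nth_map_upt add_0 minus_nat.diff_0)
  qed
  from this[of x] this[of y] have "x = y"
    using edge[of n] edge[of "Suc n"] n(2) rim y by (simp add: insert_commute)
  then have "r n = r (Suc (Suc n))" using n(2) y by simp
  then show False using inj_eq[OF inj] by simp
qed

text \<open>Besides a possible branch there are only the apex and the adjacent rim vertices. For
  even \<open>m\<close> the latter have odd index and no neighbour in the tree, so a ray cannot pass
  between the branch and these finitely many vertices.\<close>

lemma tree_fans_ray_Rim: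
  assumes "is_ray (induced (tree_fans L lad T) (neighbours (tree_fans L lad T) (Rim t m))) r"
  shows "t \<in> T \<and> (\<exists>k. m = 2 * k \<and> (\<exists>j. \<forall>n. r n = branch (lad (t k)) (j + n)))"
proof -
  let ?E = "edges (tree_fans L lad T)"
  have inj: "inj r" and nbh: "\<And>n. {Rim t m, r n} \<in> ?E" and edge: "\<And>n. {r n, r (Suc n)} \<in> ?E"
    using assms by (auto simp: is_ray_nbh)
  let ?F = "insert (Apex t) (Rim t ` {n. n = Suc m \<or> m = Suc n})"
  have "finite {n. n = Suc m \<or> m = Suc n}" by (rule finite_subset[of _ "{..Suc m}"]) auto
  then have fin: "finite ?F" by simp
  have dich: "r n \<in> ?F \<or> t \<in> T \<and> (\<exists>k j. m = 2 * k \<and> r n = branch (lad (t k)) j)" for n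
    using nbh[of n] by (cases "r n") (auto simp: tree_fans_edges)
  have sep: "{u, branch z j} \<notin> ?E" if "u \<in> ?F" "m = 2 * k" for u k z j
  proof (cases u)
    case (Rim t' i)
    then have "\<nexists>n. i = 2 * n" using that by auto presburger+
    then show ?thesis using Rim by (auto simp: branch_def tree_fans_edges)
  qed (use that in \<open>auto simp: branch_def tree_fans_edges\<close>)
  have "r n \<notin> ?F" for n
  proof
    assume n: "r n \<in> ?F"
    have "r (n + i) \<in> ?F" for i
    proof (induction i)
      case (Suc i)
      then show ?case using dich[of "Suc (n + i)"] sep[OF Suc] edge[of "n + i"] by (metis add_Suc_right)
    qed (use n in simp)
    then have "range (\<lambda>i. r (n + i)) \<subseteq> ?F" by blast
    then have "finite (range (\<lambda>i. r (n + i)))" using fin by (rule finite_subset)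
    moreover have "inj (\<lambda>i. r (n + i))" using inj_eq[OF inj] by (auto intro!: injI)
    ultimately show False using finite_imageD by blast
  qed
  then have br: "t \<in> T \<and> (\<exists>k j. m = 2 * k \<and> r n = branch (lad (t k)) j)" for n using dich by blast
  then obtain k where k: "m = 2 * k" by blast
  have "r n \<in> range (branch (lad (t k)))" for n using br[of n] k by auto
  moreover have "j = Suc i \<or> i = Suc j" if "{branch z i, branch z j} \<in> ?E" for z i j
  proof -
    from that obtain x where "map z [0..<j] = map z [0..<i] @ [x] \<or> map z [0..<i] = map z [0..<j] @ [x]"
      unfolding branch_def by (blast dest: tree_fans_edges(7))
    then have "length (map z [0..<j]) = Suc (length (map z [0..<i]))
        \<or> length (map z [0..<i]) = Suc (length (map z [0..<j]))" by (metis length_append_singleton)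
    then show ?thesis by simp
  qed
  ultimately have "\<exists>j. \<forall>n. r n = branch (lad (t k)) (j + n)"
    by (intro ray_in_path[where E = ?E] inj edge) (auto simp: inj_on_def branch_eq_iff)
  then show ?thesis using br k by blast
qed

lemma tree_fans_ray:
  assumes "is_ray (induced (tree_fans L lad T) (neighbours (tree_fans L lad T) v)) r"
  shows "\<exists>t\<in>T. (v = Apex t \<and> (\<exists>j. \<forall>n. r n = Rim t (j + n))) \<or>
    (\<exists>k. v = Rim t (2 * k) \<and> (\<exists>j. \<forall>n. r n = branch (lad (t k)) (j + n)))"
proof (cases v)
  case (Node s)
  then show ?thesis using tree_fans_no_ray_Node assms by blast
next
  case (Apex t)
  let ?E = "edges (tree_fans L lad T)"
  have r: "inj r" "\<And>n. {v, r n} \<in> ?E" "\<And>n. {r n, r (Suc n)} \<in> ?E"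
    using assms by (auto simp: is_ray_nbh)
  have t: "t \<in> T" "\<And>n. r n \<in> range (Rim t)" using r(2) Apex by (auto simp: tree_fans_edges)
  have "\<exists>j. \<forall>n. r n = Rim t (j + n)"
    by (rule ray_in_path[where E = ?E]) (use r t in \<open>auto simp: inj_on_def tree_fans_edges\<close>)
  then show ?thesis using t Apex by blast
next
  case (Rim t m)
  then show ?thesis using tree_fans_ray_Rim assms by metis
qed

lemma tree_fans_rays:
  assumes "t \<in> T" "\<And>t n j. t \<in> T \<Longrightarrow> lad (t n) j \<in> L"
  shows "is_ray (induced (tree_fans L lad T) (neighbours (tree_fans L lad T) (Apex t))) (Rim t)"
    and "is_ray (induced (tree_fans L lad T) (neighbours (tree_fans L lad T) (Rim t (2 * k)))) (branch (lad (t k)))"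
proof -
  show "is_ray (induced (tree_fans L lad T) (neighbours (tree_fans L lad T) (Apex t))) (Rim t)"
    using assms(1) by (auto simp: is_ray_nbh tree_fans_edges inj_on_def) (auto simp: tree_fans_def)
  have "{branch z n, branch z (Suc n)} \<in> edges (tree_fans L lad T)" if "\<And>j. z j \<in> L" for z n
  proof -
    have z: "map z [0..<n] \<in> lists L" "z n \<in> L"
      "{branch z n, branch z (Suc n)} = {Node (map z [0..<n]), Node (map z [0..<n] @ [z n])}"
      using that by (auto simp: branch_def)
    show ?thesis unfolding tree_fans_def snd_conv
      by (rule UnI1, rule UnI1, rule UnI1) (use z in blast)
  qed
  moreover have "branch z n \<in> verts (tree_fans L lad T)" if "\<And>j. z j \<in> L" for z n
    using that by (rule branch_in_tree_fans)
  moreover have "{Rim t (2 * k), branch (lad (t k)) n} \<in> edges (tree_fans L lad T)" for n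
    using assms(1) by (auto simp: branch_def tree_fans_edges(4))
  ultimately show "is_ray (induced (tree_fans L lad T) (neighbours (tree_fans L lad T) (Rim t (2 * k)))) (branch (lad (t k)))"
    using assms by (simp add: is_ray_nbh inj_on_def branch_eq_iff)
qed

lemma tree_fans_is_graph:
  assumes "\<And>t n j. t \<in> T \<Longrightarrow> lad (t n) j \<in> L"
  shows "is_graph (tree_fans L lad T)"
  unfolding is_graph_def
proof
  let ?G = "tree_fans L lad T"
  fix e assume "e \<in> edges ?G"
  then consider s x where "s \<in> lists L" "x \<in> L" "e = {Node s, Node (s @ [x])}"
    | t n where "t \<in> T" "e = {Apex t, Rim t n}" | t n where "t \<in> T" "e = {Rim t n, Rim t (Suc n)}"
    | t n j where "t \<in> T" "e = {Rim t (2 * n), branch (lad (t n)) j}"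
    unfolding tree_fans_def by auto
  then have "\<exists>u v. e = {u, v} \<and> u \<in> verts ?G \<and> v \<in> verts ?G \<and> u \<noteq> v"
  proof cases
    case (1 s x)
    then show ?thesis by (intro exI[of _ "Node s"] exI[of _ "Node (s @ [x])"]) (auto simp: tree_fans_def)
  next
    case (4 t n j)
    then have "branch (lad (t n)) j \<in> verts ?G" "Rim t (2 * n) \<in> verts ?G" "Rim t (2 * n) \<noteq> branch (lad (t n)) j"
      using assms by (auto intro: branch_in_tree_fans) (auto simp: tree_fans_def branch_def)
    then show ?thesis using 4 by blast
  next
    case (2 t n)
    then have "Apex t \<in> verts ?G" "Rim t n \<in> verts ?G" "Apex t \<noteq> Rim t n" by (auto simp: tree_fans_def)
    then show ?thesis using 2 by blast
  next
    case (3 t n)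
    then have "Rim t n \<in> verts ?G" "Rim t (Suc n) \<in> verts ?G" "Rim t n \<noteq> Rim t (Suc n)"
      by (auto simp: tree_fans_def)
    then show ?thesis using 3 by blast
  qed
  then show "e \<in> {{u, v} |u v. u \<in> verts ?G \<and> v \<in> verts ?G \<and> u \<noteq> v}" by blast
qed

lemma tree_fans_class:
  assumes "\<And>t n j. t \<in> T \<Longrightarrow> lad (t n) j \<in> L"
  shows "tree_fans L lad T \<in> class_G"
  unfolding class_G_def at_most_one_ray_def
proof (intro CollectI conjI ballI allI impI)
  show "is_graph (tree_fans L lad T)" using assms by (rule tree_fans_is_graph)
  fix v r s
  assume "is_ray (induced (tree_fans L lad T) (neighbours (tree_fans L lad T) v)) r"
    and "is_ray (induced (tree_fans L lad T) (neighbours (tree_fans L lad T) v)) s"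
  from this[THEN tree_fans_ray] show "tail_equivalent r s"
    by (auto intro: tail_equivalent_shifts)
qed

lemma tree_fans_card:
  assumes "infinite L" "|T| \<le>o |L|"
  shows "|verts (tree_fans L lad T)| =o |L|"
proof -
  have L: "Cinfinite |L|" using assms(1) by (simp add: cinfinite_def Field_card_of card_of_card_order_on)
  have "|verts (tree_fans L lad T)| \<le>o |L|"
    unfolding tree_fans_def fst_conv
    by (intro Un_Cinfinite_bound ordLeq_transitive[OF card_of_image] card_of_Times_bound
        card_of_nat_bound card_of_lists_infinite assms L)
  moreover have "|L| \<le>o |verts (tree_fans L lad T)|"
    by (rule card_of_ordLeqI[of "\<lambda>x. Node [x]"]) (auto simp: tree_fans_def inj_on_def)
  ultimately show ?thesis by (simp add: ordIso_iff_ordLeq)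
qed

section \<open>The invariant given by limits of rays\<close>

text \<open>Quantifying over all enumerations \<open>b\<close> removes the dependence on the names
  of the vertices. The vertex and the sequence are chosen after \<open>b\<close>, because a sequence
  is reliable only if its entries lie in the club belonging to \<open>b\<close>. The even indices
  match \<open>tree_fans\<close>.\<close>

definition ray_limits :: "'a::linorder set \<Rightarrow> ('k \<Rightarrow> (nat \<Rightarrow> 'a) set) \<Rightarrow> 'k set \<Rightarrow> 'v graph \<Rightarrow> 'k set" where
  "ray_limits L Y K G = {k \<in> K. \<forall>b. inj_on b (verts G) \<longrightarrow> b ` verts G \<subseteq> L \<longrightarrow>
    (\<exists>v\<in>verts G. \<exists>r. is_ray (induced G (neighbours G v)) r \<and> (\<exists>t\<in>Y k. \<forall>n.
      \<exists>q. is_ray (induced G (neighbours G (r (2 * n)))) q \<and> order_lim (b \<circ> q) (t n)))}"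

text \<open>Every enumeration \<open>b\<close> of \<open>H\<close> induces the enumeration
  \<open>b \<circ> f\<close> of \<open>G\<close>, and witnesses are carried over by
  \<open>f\<close>.\<close>

lemma ray_limits_mono:
  assumes "weakly_embeds G H"
  shows "ray_limits L Y K G \<subseteq> ray_limits L Y K H"
proof
  obtain f where f: "inj_on f (verts G)" "f ` verts G \<subseteq> verts H"
    "\<And>u v. {u, v} \<in> edges G \<Longrightarrow> {f u, f v} \<in> edges H"
    using weakly_embedsE[OF assms] by blast
  have ray: "is_ray (induced H (neighbours H (f v))) (f \<circ> r)"
    if "is_ray (induced G (neighbours G v)) r" for v r
    using f that by (rule ray_nbh_image)
  fix k assume k: "k \<in> ray_limits L Y K G"
  have "\<exists>v\<in>verts H. \<exists>r. is_ray (induced H (neighbours H v)) r \<and> (\<exists>t\<in>Y k. \<forall>n.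
      \<exists>q. is_ray (induced H (neighbours H (r (2 * n)))) q \<and> order_lim (b \<circ> q) (t n))"
    if b: "inj_on b (verts H)" "b ` verts H \<subseteq> L" for b
  proof -
    have "inj_on (b \<circ> f) (verts G)" using f(1,2) b(1) by (meson comp_inj_on inj_on_subset)
    moreover have "(b \<circ> f) ` verts G \<subseteq> L" using f(2) b(2) by auto
    ultimately obtain v r t where v: "v \<in> verts G" "is_ray (induced G (neighbours G v)) r" "t \<in> Y k"
      and q: "\<And>n. \<exists>q. is_ray (induced G (neighbours G (r (2 * n)))) q \<and> order_lim (b \<circ> f \<circ> q) (t n)"
      using k unfolding ray_limits_def by blast
    have "\<exists>q. is_ray (induced H (neighbours H ((f \<circ> r) (2 * n)))) q \<and> order_lim (b \<circ> q) (t n)" for n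
      using q[of n] ray by (metis comp_apply comp_assoc)
    then show ?thesis using v ray[OF v(2)] f(2) by blast
  qed
  then show "k \<in> ray_limits L Y K H" using k unfolding ray_limits_def by blast
qed

lemma order_lim_ray_unique:
  assumes "G \<in> class_G" "v \<in> verts G"
    and "is_ray (induced G (neighbours G v)) q" "order_lim (b \<circ> q) y"
    and "is_ray (induced G (neighbours G v)) q'" "order_lim (b \<circ> q') y'"
  shows "y = y'"
proof -
  obtain i j where ij: "\<And>k. q (i + k) = q' (j + k)"
    using assms(1-3,5) unfolding class_G_def at_most_one_ray_def tail_equivalent_def by blast
  have "order_lim (\<lambda>k. (b \<circ> q) (i + k)) y" using assms(4) by (simp only: order_lim_tail)
  moreover have "order_lim (\<lambda>k. (b \<circ> q) (i + k)) y'"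
    using order_lim_tail[of "b \<circ> q'" j y'] assms(6) ij by simp
  ultimately show ?thesis by (rule order_lim_unique)
qed

text \<open>One enumeration suffices for the bound: there each ray determines the limits at its even
  vertices and hence at most one colour.\<close>

lemma ray_limits_card:
  assumes G: "G \<in> class_G" "|verts G| \<le>o |L|" and L: "infinite L"
    and disj: "\<And>k k' t t'. k \<in> K \<Longrightarrow> k' \<in> K \<Longrightarrow> t \<in> Y k \<Longrightarrow> t' \<in> Y k' \<Longrightarrow> tail_equivalent t t' \<Longrightarrow> k = k'"
  shows "|ray_limits L Y K G| \<le>o |L|"
proof -
  let ?R = "{q. \<exists>v\<in>verts G. is_ray (induced G (neighbours G v)) q}"
  obtain b where b: "inj_on b (verts G)" "b ` verts G \<subseteq> L"
    using G(2) unfolding card_of_ordLeq[symmetric] by blast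
  define reads where "reads r k \<longleftrightarrow> k \<in> K \<and> (\<exists>t\<in>Y k. \<forall>n.
      \<exists>q. is_ray (induced G (neighbours G (r (2 * n)))) q \<and> order_lim (b \<circ> q) (t n))" for r k
  have uniq: "k = k'" if r: "r \<in> ?R" and k: "reads r k" "reads r k'" for r k k'
  proof -
    obtain t where t: "t \<in> Y k" "k \<in> K"
      "\<And>n. \<exists>q. is_ray (induced G (neighbours G (r (2 * n)))) q \<and> order_lim (b \<circ> q) (t n)"
      using k(1) unfolding reads_def by blast
    obtain t' where t': "t' \<in> Y k'" "k' \<in> K"
      "\<And>n. \<exists>q. is_ray (induced G (neighbours G (r (2 * n)))) q \<and> order_lim (b \<circ> q) (t' n)"
      using k(2) unfolding reads_def by blast
    have "r n \<in> verts G" for n using r by (auto simp: is_ray_nbh)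
    then have "t n = t' n" for n using t(3)[of n] t'(3)[of n] order_lim_ray_unique[OF G(1)] by blast
    then have "tail_equivalent t t'" unfolding tail_equivalent_def by auto
    then show ?thesis using disj t t' by blast
  qed
  have "ray_limits L Y K G \<subseteq> (\<lambda>r. THE k. reads r k) ` ?R"
  proof
    fix k assume "k \<in> ray_limits L Y K G"
    then obtain r where r: "r \<in> ?R" "reads r k"
      unfolding ray_limits_def reads_def using b by blast
    then have "(THE k. reads r k) = k" using uniq by blast
    then show "k \<in> (\<lambda>r. THE k. reads r k) ` ?R" using r(1) by blast
  qed
  then have "|ray_limits L Y K G| \<le>o |?R|" by (rule surj_imp_ordLeq)
  also have "|?R| \<le>o |L|"
    using G L by (intro card_of_nbh_rays) (auto simp: cinfinite_def Field_card_of card_of_card_order_on)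
  finally show ?thesis .
qed

context regular_cardinal
begin

lemma infinite_L: "infinite L"
  using Cinfinite_L by (simp add: cinfinite_def Field_card_of)

lemma list_bounded:
  assumes "s \<in> lists L"
  shows "\<exists>e\<in>L. \<forall>a\<in>set s. a < e"
proof -
  have "|set s| <o natLeq" by (simp add: finite_iff_ordLess_natLeq[symmetric])
  then have "|set s| <o |L|" using uncountable ordLess_transitive by blast
  moreover have "set s \<subseteq> L" using assms by auto
  ultimately show ?thesis using bounded by blast
qed

lemma card_of_lists_atMost: "x \<in> L \<Longrightarrow> |lists {..x}| <o |L|"
proof (cases "finite {..x}")
  case True
  then have "|{..x}| \<le>o natLeq" by (simp add: finite_iff_ordLess_natLeq ordLess_imp_ordLeq)
  then have "|lists {..x}| \<le>o natLeq" by (rule card_of_lists_bound[OF natLeq_Cinfinite])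
  then show ?thesis using uncountable ordLeq_ordLess_trans by blast
next
  case False
  assume "x \<in> L"
  then show ?thesis using card_of_lists_infinite[OF False] atMost_card_less ordLeq_ordLess_trans by blast
qed

text \<open>\<open>h\<close> closes off under \<open>b\<close> and its inverse. For a closure point
  \<open>y\<close>, finite lists below \<open>y\<close> have values below \<open>y\<close>; and a
  list with value at most \<open>x < y\<close> has all entries below \<open>h x < y\<close>, which
  fails once the branch has passed a ladder entry above \<open>h x\<close>.\<close>

lemma branch_limit:
  fixes b :: "'a list \<Rightarrow> 'a"
  assumes b: "inj_on b (lists L)" "b ` lists L \<subseteq> L"
  shows "\<exists>h\<in>L \<rightarrow> L. \<forall>y\<in>Cl h \<inter> ladder_points. order_lim (\<lambda>j. b (map (ladder y) [0..<j])) y"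
proof -
  obtain e where e: "\<And>s. s \<in> lists L \<Longrightarrow> e s \<in> L" "\<And>s a. s \<in> lists L \<Longrightarrow> a \<in> set s \<Longrightarrow> a < e s"
    using list_bounded by metis
  have "\<exists>c\<in>L. (\<forall>s\<in>lists {..x}. b s < c) \<and> (\<forall>s\<in>lists L. b s \<le> x \<longrightarrow> e s < c)" if x: "x \<in> L" for x
  proof -
    have "{..x} \<subseteq> L" using down_le[OF x] by auto
    then have "b s \<in> L" if "s \<in> lists {..x}" for s
      using subsetD[OF lists_mono that] subsetD[OF b(2) imageI] by simp
    then obtain c1 where c1: "c1 \<in> L" "\<forall>s\<in>lists {..x}. b s < c1"
      using image_bounded[OF card_of_lists_atMost[OF x], of b] by blast
    let ?S = "{s \<in> lists L. b s \<le> x}"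
    have "|?S| \<le>o |{..x}|" by (rule card_of_ordLeqI[of b]) (use b(1) in \<open>auto intro: inj_on_subset\<close>)
    then have "|?S| <o |L|" using atMost_card_less[OF x] by (rule ordLeq_ordLess_trans)
    then obtain c2 where c2: "c2 \<in> L" "\<forall>s\<in>?S. e s < c2" using image_bounded[of ?S e] e(1) by blast
    have "max c1 c2 \<in> L" using c1(1) c2(1) by (simp add: max_def)
    moreover have "\<forall>s\<in>lists {..x}. b s < max c1 c2" using c1(2) by (simp add: less_max_iff_disj)
    moreover have "\<forall>s\<in>lists L. b s \<le> x \<longrightarrow> e s < max c1 c2" using c2(2) by (simp add: less_max_iff_disj)
    ultimately show ?thesis by blast
  qed
  then obtain h where h: "\<And>x. x \<in> L \<Longrightarrow> h x \<in> L" "\<And>x s. x \<in> L \<Longrightarrow> s \<in> lists {..x} \<Longrightarrow> b s < h x"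
    "\<And>x s. x \<in> L \<Longrightarrow> s \<in> lists L \<Longrightarrow> b s \<le> x \<Longrightarrow> e s < h x" unfolding Bex_def by metis
  have "order_lim (\<lambda>j. b (map (ladder y) [0..<j])) y" if y: "y \<in> Cl h" "y \<in> ladder_points" for y
  proof -
    have below: "x \<in> L" "h x < y" if "x < y" for x using y(1) that down unfolding Cl_def by auto
    have s: "map (ladder y) [0..<j] \<in> lists L" for j using ladder_L[OF y(2)] by auto
    have "b (map (ladder y) [0..<j]) < y" for j
    proof -
      let ?x = "Max (ladder y ` {..j})"
      have x: "?x < y" using ladder(1)[OF y(2)] by (subst Max_less_iff) auto
      have "map (ladder y) [0..<j] \<in> lists {..?x}" by (auto intro!: Max_ge)
      then have "b (map (ladder y) [0..<j]) < h ?x" using h(2) below(1)[OF x] by blast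
      also have "h ?x < y" using below(2)[OF x] .
      finally show ?thesis .
    qed
    moreover have "\<exists>N. \<forall>j\<ge>N. x < b (map (ladder y) [0..<j])" if x: "x < y" for x
    proof -
      obtain N where N: "h x < ladder y N"
        using ladder(2)[OF y(2)] below(2)[OF x] unfolding order_lim_def by blast
      have "x < b (map (ladder y) [0..<j])" if j: "j \<ge> Suc N" for j
      proof (rule ccontr)
        assume "\<not> ?thesis"
        then have "e (map (ladder y) [0..<j]) < h x" using h(3)[OF below(1)[OF x] s] by simp
        moreover have "ladder y N < e (map (ladder y) [0..<j])" using e(2)[OF s] j by simp
        ultimately show False using N by simp
      qed
      then show ?thesis by blast
    qed
    ultimately show ?thesis unfolding order_lim_def by blast
  qed
  then show ?thesis using h(1) by (intro bexI[of _ h]) auto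
qed

text \<open>To exclude colours outside \<open>A\<close>, an enumeration of the tree is fixed in
  advance and \<open>T\<close> admits only sequences in its club \<open>Cl h0\<close>; in that
  enumeration the limits are exactly the entries of sequences in \<open>T\<close>. For a colour in
  \<open>A\<close> and an arbitrary enumeration, guessing inside both clubs yields a sequence that
  belongs to \<open>T\<close> and is read correctly.\<close>

lemma ray_limits_tree_fans:
  fixes Y :: "'k \<Rightarrow> (nat \<Rightarrow> 'a) set"
  assumes Y: "\<And>k. k \<in> K \<Longrightarrow> |Y k| \<le>o |L|" "\<And>k t n. k \<in> K \<Longrightarrow> t \<in> Y k \<Longrightarrow> t n \<in> ladder_points"
    and disj: "\<And>k k' t t'. k \<in> K \<Longrightarrow> k' \<in> K \<Longrightarrow> t \<in> Y k \<Longrightarrow> t' \<in> Y k' \<Longrightarrow> tail_equivalent t t' \<Longrightarrow> k = k'"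
    and guess: "\<And>k h. k \<in> K \<Longrightarrow> h \<in> L \<rightarrow> L \<Longrightarrow> \<exists>t\<in>Y k. range t \<subseteq> Cl h"
    and A: "A \<subseteq> K" "|A| \<le>o |L|"
  shows "\<exists>T. tree_fans L ladder T \<in> class_G \<and> |verts (tree_fans L ladder T)| =o |L| \<and>
    ray_limits L Y K (tree_fans L ladder T) = A"
proof -
  have "|lists L| \<le>o |L|" using infinite_L by (rule card_of_lists_infinite)
  \<comment> \<open>The second summand leaves room for apices and rims, as \<open>T\<close> is
    chosen only after \<open>\<beta>\<close> and its club.\<close>
  then have "|lists L <+> L| \<le>o |L|"
    using Cinfinite_L by (intro card_of_Plus_ordLeq_infinite_Field) (auto simp: cinfinite_def Field_card_of intro: ordLeq_refl)
  then obtain \<beta> where \<beta>: "inj_on \<beta> (lists L <+> L)" "\<beta> ` (lists L <+> L) \<subseteq> L"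
    unfolding card_of_ordLeq[symmetric] by blast
  have "inj_on (\<beta> \<circ> Inl) (lists L)" using \<beta>(1) by (auto simp: inj_on_def)
  moreover have "(\<beta> \<circ> Inl) ` lists L \<subseteq> L" using \<beta>(2) by auto
  ultimately obtain h0 where h0: "h0 \<in> L \<rightarrow> L"
    "\<And>y. y \<in> Cl h0 \<Longrightarrow> y \<in> ladder_points \<Longrightarrow> order_lim (\<lambda>j. \<beta> (Inl (map (ladder y) [0..<j]))) y"
    using branch_limit[of "\<beta> \<circ> Inl"] by auto
  define T where "T = {t \<in> (\<Union>k\<in>A. Y k). range t \<subseteq> Cl h0}"
  let ?G = "tree_fans L ladder T"
  have TK: "\<exists>k\<in>A. k \<in> K \<and> t \<in> Y k" if "t \<in> T" for t using that A(1) unfolding T_def by blast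
  have Tpt: "t n \<in> ladder_points" if "t \<in> T" for t n using TK[OF that] Y(2) by blast
  have Tlad: "ladder (t n) j \<in> L" if "t \<in> T" for t n j using Tpt[OF that] ladder_L by blast
  have "|T| \<le>o |\<Union>k\<in>A. Y k|" unfolding T_def by (intro card_of_mono1) blast
  also have "|\<Union>k\<in>A. Y k| \<le>o |L|" using A Y(1) Cinfinite_L by (intro UNION_Cinfinite_bound) auto
  finally have T: "|T| \<le>o |L|" .
  have G: "?G \<in> class_G" "|verts ?G| =o |L|"
    using tree_fans_class[of T ladder L] Tlad tree_fans_card[OF infinite_L T] by blast+
  have "k \<in> A" if k: "k \<in> ray_limits L Y K ?G" for k
  proof -
    let ?V = "Apex ` T \<union> case_prod Rim ` (T \<times> UNIV)"
    have "|?V| \<le>o |L|"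
      by (intro Un_Cinfinite_bound ordLeq_transitive[OF card_of_image] card_of_Times_bound
        card_of_nat_bound T Cinfinite_L)
    then obtain i where i: "inj_on i ?V" "i ` ?V \<subseteq> L" unfolding card_of_ordLeq[symmetric] by blast
    define b where "b v = (case v of Node s \<Rightarrow> \<beta> (Inl s) | _ \<Rightarrow> \<beta> (Inr (i v)))" for v
    have b_Node: "b (Node s) = \<beta> (Inl s)" for s by (simp add: b_def)
    have b_V: "b v = \<beta> (Inr (i v))" "i v \<in> L" if "v \<in> ?V" for v using that i(2) by (auto simp: b_def)
    have "b ` verts ?G \<subseteq> L"
    proof
      fix x assume "x \<in> b ` verts ?G"
      then obtain v where v: "v \<in> verts ?G" "x = b v" by blast
      show "x \<in> L"
      proof (cases "v \<in> ?V")
        case True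
        then show ?thesis using v(2) b_V[OF True] \<beta>(2) by auto
      next
        case False
        then obtain s where "v = Node s" "s \<in> lists L" using v(1) unfolding tree_fans_def by auto
        then show ?thesis using v(2) b_Node \<beta>(2) by auto
      qed
    qed
    moreover have "inj_on b (verts ?G)"
    proof (rule inj_onI)
      fix u v assume uv: "u \<in> verts ?G" "v \<in> verts ?G" "b u = b v"
      define c where "c w = (case w of Node s \<Rightarrow> Inl s | _ \<Rightarrow> Inr (i w))" for w
      have c: "c w \<in> lists L <+> L" "b w = \<beta> (c w)" if "w \<in> verts ?G" for w
        using that i(2) by (auto simp: c_def b_def tree_fans_def image_subset_iff)
      have cuv: "c u = c v" using \<beta>(1) c[OF uv(1)] c[OF uv(2)] uv(3) by (auto dest: inj_onD)
      show "u = v"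
      proof (cases "u \<in> ?V \<and> v \<in> ?V")
        case True
        then have "i u = i v" using cuv by (auto simp: c_def)
        then show ?thesis using i(1) True by (auto dest: inj_onD)
      next
        case False
        then show ?thesis using uv(1,2) cuv by (auto simp: c_def tree_fans_def)
      qed
    qed
    ultimately obtain v r t where r: "is_ray (induced ?G (neighbours ?G v)) r" and t: "t \<in> Y k"
      and q: "\<And>n. \<exists>q. is_ray (induced ?G (neighbours ?G (r (2 * n)))) q \<and> order_lim (b \<circ> q) (t n)"
      using k unfolding ray_limits_def by blast
    have kK: "k \<in> K" using k unfolding ray_limits_def by blast
    obtain q0 where q0: "is_ray (induced ?G (neighbours ?G (r 0))) q0" using q[of 0] by auto
    \<comment> \<open>Nodes have no ray in their neighbourhood, so \<open>r\<close> runs along a rim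
      and not along a branch.\<close>
    have "\<not> (\<exists>s. r 0 = Node s)" using q0 tree_fans_no_ray_Node by metis
    then have "\<not> (\<exists>z j. \<forall>n. r n = branch z (j + n))" unfolding branch_def by blast
    then obtain t' j where t': "t' \<in> T" "\<And>n. r n = Rim t' (j + n)" using tree_fans_ray[OF r] by blast
    have key: "\<exists>m. j + 2 * n = 2 * m \<and> t n = t' m" for n
    proof -
      obtain q where q: "is_ray (induced ?G (neighbours ?G (r (2 * n)))) q" "order_lim (b \<circ> q) (t n)"
        using q by blast
      then obtain m i where m: "j + 2 * n = 2 * m" "\<And>n. q n = branch (ladder (t' m)) (i + n)"
        using tree_fans_ray_Rim[of L ladder T t' "j + 2 * n" q] t'(2) by auto
      have "t' m \<in> Cl h0" using t'(1) unfolding T_def by auto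
      then have "order_lim (\<lambda>j. \<beta> (Inl (map (ladder (t' m)) [0..<j]))) (t' m)"
        using h0(2) Tpt[OF t'(1)] by blast
      then have "order_lim (\<lambda>n. \<beta> (Inl (map (ladder (t' m)) [0..<i + n]))) (t' m)"
        using order_lim_tail[of "\<lambda>j. \<beta> (Inl (map (ladder (t' m)) [0..<j]))" i] by simp
      moreover have "b \<circ> q = (\<lambda>n. \<beta> (Inl (map (ladder (t' m)) [0..<i + n])))"
        using m(2) b_Node by (auto simp: branch_def)
      ultimately have "t n = t' m" using q(2) order_lim_unique by metis
      then show ?thesis using m(1) by blast
    qed
    \<comment> \<open>The ray may enter the rim at any even index \<open>j\<close>, which shifts the
      sequence by \<open>m\<close>; hence the separation of colours up to tail equivalence.\<close>
    obtain m where m: "j = 2 * m" using key[of 0] by auto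
    have "t n = t' (m + n)" for n
    proof -
      obtain m' where m': "j + 2 * n = 2 * m'" "t n = t' m'" using key by blast
      then have "m' = m + n" using m by simp
      then show ?thesis using m'(2) by simp
    qed
    then have "tail_equivalent t t'" unfolding tail_equivalent_def by (intro exI[of _ 0] exI[of _ m]) simp
    then show "k \<in> A" using TK[OF t'(1)] disj[OF kK _ t] by blast
  qed
  moreover have "k \<in> ray_limits L Y K ?G" if k: "k \<in> A" for k
  proof -
    have kK: "k \<in> K" using k A(1) by blast
    have "\<exists>v\<in>verts ?G. \<exists>r. is_ray (induced ?G (neighbours ?G v)) r \<and> (\<exists>t\<in>Y k. \<forall>n.
      \<exists>q. is_ray (induced ?G (neighbours ?G (r (2 * n)))) q \<and> order_lim (b \<circ> q) (t n))"
      if b: "inj_on b (verts ?G)" "b ` verts ?G \<subseteq> L" for b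
    proof -
      have sub: "Node ` lists L \<subseteq> verts ?G" by (auto simp: tree_fans_def)
      have "inj_on (b \<circ> Node) (lists L)"
        using b(1) sub by (intro comp_inj_on) (auto simp: inj_on_def subset_iff)
      moreover have "(b \<circ> Node) ` lists L \<subseteq> L" using b(2) sub by auto
      ultimately obtain h where h: "h \<in> L \<rightarrow> L"
        "\<And>y. y \<in> Cl h \<Longrightarrow> y \<in> ladder_points \<Longrightarrow> order_lim (\<lambda>j. b (Node (map (ladder y) [0..<j]))) y"
        using branch_limit[of "b \<circ> Node"] by auto
      let ?g = "\<lambda>x. max (h x) (h0 x)"
      have "?g \<in> L \<rightarrow> L" using h(1) h0(1) by (auto simp: max_def)
      then obtain t where t: "t \<in> Y k" "range t \<subseteq> Cl ?g" using guess[OF kK] by blast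
      have "Cl ?g \<subseteq> Cl h" "Cl ?g \<subseteq> Cl h0" by (rule Cl_antimono; simp)+
      then have tCl: "range t \<subseteq> Cl h" "range t \<subseteq> Cl h0" using t(2) by blast+
      then have tT: "t \<in> T" using k t(1) unfolding T_def by blast
      have "order_lim (b \<circ> branch (ladder (t n))) (t n)" for n
        using h(2)[of "t n"] tCl(1) Tpt[OF tT] by (auto simp: comp_def branch_def)
      then have "\<exists>q. is_ray (induced ?G (neighbours ?G (Rim t (2 * n)))) q \<and> order_lim (b \<circ> q) (t n)" for n
        using tree_fans_rays(2)[where lad = ladder and L = L, OF tT] Tlad by blast
      moreover have "Apex t \<in> verts ?G" using tT by (auto simp: tree_fans_def)
      moreover have "is_ray (induced ?G (neighbours ?G (Apex t))) (Rim t)"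
        using tree_fans_rays(1)[where lad = ladder and L = L, OF tT] Tlad by blast
      ultimately show ?thesis using t(1) by blast
    qed
    then show ?thesis using kK unfolding ray_limits_def by blast
  qed
  ultimately have "ray_limits L Y K ?G = A" by blast
  then show ?thesis using G by blast
qed

theorem surjective_hom_of_guessing:
  fixes Y :: "'k \<Rightarrow> (nat \<Rightarrow> 'a) set" and l :: "'l rel" and M :: "'m set"
  assumes "\<And>k. k \<in> K \<Longrightarrow> |Y k| \<le>o |L|" "\<And>k t n. k \<in> K \<Longrightarrow> t \<in> Y k \<Longrightarrow> t n \<in> ladder_points"
    and disj: "\<And>k k' t t'. k \<in> K \<Longrightarrow> k' \<in> K \<Longrightarrow> t \<in> Y k \<Longrightarrow> t' \<in> Y k' \<Longrightarrow> tail_equivalent t t' \<Longrightarrow> k = k'"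
    and "\<And>k h. k \<in> K \<Longrightarrow> h \<in> L \<rightarrow> L \<Longrightarrow> \<exists>t\<in>Y k. range t \<subseteq> Cl h"
    and l: "Card_order l" "|L| =o l" and M: "|M| \<le>o |K|"
  shows "\<exists>\<Phi> :: 'l graph set \<Rightarrow> 'm set. monotone_on (iso_types l) le_w (\<subseteq>) \<Phi> \<and>
    \<Phi> ` iso_types l = {A. A \<subseteq> M \<and> |A| \<le>o l}"
proof (rule surjective_hom_of_invariant[OF _ _ _ M])
  show "|ray_limits L Y K G| \<le>o l" if G: "G \<in> graphs_of_size l" for G
  proof -
    have "|verts G| =o |L|"
      using G ordIso_transitive[OF _ ordIso_symmetric[OF l(2)]] unfolding graphs_of_size_def by blast
    then have "|ray_limits L Y K G| \<le>o |L|"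
      using G infinite_L disj by (intro ray_limits_card) (auto simp: graphs_of_size_def ordIso_imp_ordLeq)
    then show ?thesis using l(2) ordLeq_ordIso_trans by blast
  qed
  show "\<exists>G\<in>graphs_of_size l. ray_limits L Y K G = A" if A: "A \<subseteq> K" "|A| \<le>o l" for A
  proof -
    have "|A| \<le>o |L|" using A(2) ordIso_symmetric[OF l(2)] by (rule ordLeq_ordIso_trans)
    then obtain T where T: "tree_fans L ladder T \<in> class_G" "|verts (tree_fans L ladder T)| =o |L|"
      "ray_limits L Y K (tree_fans L ladder T) = A"
      using ray_limits_tree_fans[where K = K and Y = Y and A = A] assms(1-4) A(1) by blast
    let ?G = "tree_fans L ladder T"
    obtain H where H: "H \<in> graphs_of_size l" "graph_iso ?G H"
      using class_G_representative[OF T(1) l(1) ordIso_transitive[OF T(2) l(2)]] by blast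
    have gr: "is_graph ?G" "is_graph H" using T(1) H(1) by (auto simp: graphs_of_size_def class_G_def)
    have "ray_limits L Y K H = ray_limits L Y K ?G"
      using ray_limits_mono[OF graph_iso_imp_weakly_embeds[OF gr(1) H(2)], of L Y K]
        ray_limits_mono[OF graph_iso_imp_weakly_embeds[OF gr(2) graph_iso_sym[OF gr(1) H(2)]], of L Y K]
      by blast
    then show ?thesis using H(1) T(3) by blast
  qed
qed (rule ray_limits_mono)

end

section \<open>Choice of the colours\<close>

text \<open>A maximal independent set dominates \<open>E\<close>, so \<open>E\<close> is covered by
  \<open>|K|\<close> sets of size at most \<open>r\<close>. As \<open>r <o |E|\<close>, this first
  excludes \<open>|K| \<le>o r\<close> and then gives the full size.\<close>

lemma independent_set_card:
  fixes rel :: "'e \<Rightarrow> 'e \<Rightarrow> bool"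
  assumes r: "Cinfinite r" "r <o |E|"
    and refl: "\<And>x. x \<in> E \<Longrightarrow> rel x x" and sym: "\<And>x y. rel x y \<Longrightarrow> rel y x"
    and deg: "\<And>y. y \<in> E \<Longrightarrow> |{x \<in> E. rel x y}| \<le>o r"
  shows "\<exists>K\<subseteq>E. pairwise (\<lambda>x y. \<not> rel x y) K \<and> |E| \<le>o |K|"
proof -
  let ?I = "{K. K \<subseteq> E \<and> pairwise (\<lambda>x y. \<not> rel x y) K}"
  have "\<exists>K\<in>?I. \<forall>X\<in>?I. K \<subseteq> X \<longrightarrow> X = K"
  proof (rule subset_Zorn')
    fix C assume C: "subset.chain ?I C"
    then have "chain\<^sub>\<subseteq> C" unfolding subset.chain_def chain_subset_def by blast
    moreover have "\<And>S. S \<in> C \<Longrightarrow> pairwise (\<lambda>x y. \<not> rel x y) S" using C unfolding subset.chain_def by blast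
    ultimately have "pairwise (\<lambda>x y. \<not> rel x y) (\<Union>C)" by (intro pairwise_chain_Union)
    moreover have "\<Union>C \<subseteq> E" using C unfolding subset.chain_def by blast
    ultimately show "\<Union>C \<in> ?I" by blast
  qed
  then obtain K where KI: "K \<in> ?I" and max: "\<And>X. X \<in> ?I \<Longrightarrow> K \<subseteq> X \<Longrightarrow> X = K" by meson
  then have K: "K \<subseteq> E" "pairwise (\<lambda>x y. \<not> rel x y) K" by simp_all
  have cover: "E \<subseteq> (\<Union>y\<in>K. {x \<in> E. rel x y})"
  proof
    fix x assume x: "x \<in> E"
    have "\<exists>y\<in>K. rel x y"
    proof (rule ccontr)
      assume no: "\<not> ?thesis"
      then have "pairwise (\<lambda>x y. \<not> rel x y) (insert x K)"
        using K(2) sym by (auto simp: pairwise_insert)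
      then have "insert x K = K" using max[of "insert x K"] K(1) x by blast
      then show False using no refl[OF x] by blast
    qed
    then show "x \<in> (\<Union>y\<in>K. {x \<in> E. rel x y})" using x by blast
  qed
  have bound: "|E| \<le>o s" if s: "Cinfinite s" "|K| \<le>o s" "r \<le>o s" for s :: "'s rel"
  proof -
    have "|\<Union>y\<in>K. {x \<in> E. rel x y}| \<le>o s"
      using K(1) deg s(3) by (intro UNION_Cinfinite_bound[OF s(2) _ s(1)]) (blast intro: ordLeq_transitive)
    then show ?thesis using card_of_mono1[OF cover] ordLeq_transitive by blast
  qed
  have "\<not> |K| \<le>o r"
    using bound[OF r(1) _ ordLeq_refl] r not_ordLess_ordLeq by blast
  then have rK: "r \<le>o |K|"
    using r(1) ordLeq_total[of r "|K|"] card_of_Well_order card_order_on_well_order_on by blast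
  have "Cinfinite |K|" using cinfinite_mono[OF rK] r(1) card_of_Card_order[of K] by simp
  then have "|E| \<le>o |K|" by (rule bound[OF _ ordLeq_refl[OF card_of_Card_order] rK])
  then show ?thesis using K by blast
qed

context regular_cardinal
begin

text \<open>Constant sequences code the stationary pieces: a point \<open>y\<close> determines its
  colour \<open>ladder y n\<close>, and constant sequences with a common tail are equal.\<close>

lemma surjective_hom_small:
  fixes l :: "'l rel" and M :: "'m set"
  assumes l: "Card_order l" "|L| =o l" and M: "|M| \<le>o |L|"
  shows "\<exists>\<Phi> :: 'l graph set \<Rightarrow> 'm set. monotone_on (iso_types l) le_w (\<subseteq>) \<Phi> \<and>
    \<Phi> ` iso_types l = {A. A \<subseteq> M \<and> |A| \<le>o l}"
proof -
  obtain n where n: "|L| \<le>o |{a \<in> L. \<forall>h \<in> L \<rightarrow> L. \<exists>y \<in> Cl h \<inter> ladder_points. ladder y n = a}|" (is "_ \<le>o |?K|")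
    using stationary_splitting by blast
  define Y where "Y a = (\<lambda>y (_ :: nat). y) ` {y \<in> ladder_points. ladder y n = a}" for a
  show ?thesis
  proof (rule surjective_hom_of_guessing[where K = ?K and Y = Y])
    fix k
    have "|Y k| \<le>o |{y \<in> ladder_points. ladder y n = k}|" unfolding Y_def by (rule card_of_image)
    also have "|{y \<in> ladder_points. ladder y n = k}| \<le>o |L|"
      by (rule card_of_mono1) (auto dest: ladder_points_L)
    finally show "|Y k| \<le>o |L|" .
  next
    fix k h assume "k \<in> ?K" "h \<in> L \<rightarrow> L"
    then obtain y where "y \<in> Cl h" "y \<in> ladder_points" "ladder y n = k" by blast
    then have "(\<lambda>_. y) \<in> Y k" "range (\<lambda>_ :: nat. y) \<subseteq> Cl h" unfolding Y_def by auto
    then show "\<exists>t\<in>Y k. range t \<subseteq> Cl h" by blast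
  next
    show "|M| \<le>o |?K|" using M n by (rule ordLeq_transitive)
  qed (use l in \<open>auto simp: Y_def tail_equivalent_def\<close>)
qed

text \<open>Colours are sequences \<open>\<eta>\<close> in \<open>N\<close>. Entry \<open>n\<close>
  of \<open>y c \<eta>\<close> codes the initial segment of \<open>\<eta>\<close> of length
  \<open>n\<close>, so every tail determines \<open>\<eta>\<close>. All entries lie in the image of
  \<open>N\<close> under \<open>c\<close>, so a club containing that image contains them.\<close>

lemma surjective_hom_large:
  fixes l :: "'l rel" and N :: "'m set"
  assumes l: "Card_order l" "|L| =o l" and N: "infinite N" "cardSuc |N| <o |L|"
    and large: "|L| <o |Func (UNIV :: nat set) N|"
  shows "\<exists>\<Phi> :: 'l graph set \<Rightarrow> (nat \<Rightarrow> 'm) set. monotone_on (iso_types l) le_w (\<subseteq>) \<Phi> \<and>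
    \<Phi> ` iso_types l = {A. A \<subseteq> Func UNIV N \<and> |A| \<le>o l}"
proof -
  let ?E = "Func (UNIV :: nat set) N"
  obtain C :: "('m \<Rightarrow> 'a) set" where C1: "|C| \<le>o |L|" and C23: "\<forall>c\<in>C. inj_on c N \<and> c ` N \<subseteq> ladder_points"
      and C4: "\<forall>h\<in>L \<rightarrow> L. \<exists>c\<in>C. c ` N \<subseteq> Cl h"
    using guessing[OF N] by (elim exE conjE)
  have C: "|C| \<le>o |L|" "\<And>c. c \<in> C \<Longrightarrow> inj_on c N" "\<And>c. c \<in> C \<Longrightarrow> c ` N \<subseteq> ladder_points"
      "\<And>h. h \<in> L \<rightarrow> L \<Longrightarrow> \<exists>c\<in>C. c ` N \<subseteq> Cl h"
    by (rule C1, use C23 in blast, use C23 in blast, rule bspec[OF C4])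
  obtain code where code: "inj_on code (lists N)" "code ` lists N \<subseteq> N"
    using card_of_lists_infinite[OF N(1)] unfolding card_of_ordLeq[symmetric] by blast
  define y where "y c \<eta> n = c (code (map \<eta> [0..<n]))" for c :: "'m \<Rightarrow> 'a" and \<eta> :: "nat \<Rightarrow> 'm" and n :: nat
  have codeN: "code (map \<eta> [0..<n]) \<in> N" if "\<eta> \<in> ?E" for \<eta> n
  proof -
    have "map \<eta> [0..<n] \<in> lists N" using that by (auto simp: Func_def)
    then show ?thesis using code(2) by blast
  qed
  have y_inj: "\<eta> = \<theta>" if "c \<in> C" "\<eta> \<in> ?E" "\<theta> \<in> ?E" and eq: "\<And>k. y c \<eta> (i + k) = y c \<theta> (i + k)" for c \<eta> \<theta> i
  proof
    fix n
    \<comment> \<open>An initial segment of length \<open>i + Suc n\<close> contains entry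
      \<open>n\<close> whatever the offset \<open>i\<close> is.\<close>
    have "code (map \<eta> [0..<i + Suc n]) = code (map \<theta> [0..<i + Suc n])"
      using eq[of "Suc n"] inj_onD[OF C(2)[OF that(1)]] codeN that(2,3) unfolding y_def by blast
    moreover have "map \<eta> [0..<i + Suc n] \<in> lists N" "map \<theta> [0..<i + Suc n] \<in> lists N"
      using that(2,3) by (auto simp: Func_def)
    ultimately have "map \<eta> [0..<i + Suc n] = map \<theta> [0..<i + Suc n]" using code(1) by (blast dest: inj_onD)
    then show "\<eta> n = \<theta> n" by (simp add: map_eq_conv del: upt_Suc)
  qed
  \<comment> \<open>Different sequences may be read off the same ray through different members of \<open>C\<close>; since this
    identifies only \<open>|L|\<close> many with each one, an independent set of full size remains.\<close>
  define rel where "rel \<eta> \<theta> \<longleftrightarrow> (\<exists>c\<in>C. \<exists>d\<in>C. tail_equivalent (y c \<eta>) (y d \<theta>))" for \<eta> \<theta>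
  have "\<exists>K\<subseteq>?E. pairwise (\<lambda>x y. \<not> rel x y) K \<and> |?E| \<le>o |K|"
  proof (rule independent_set_card[OF Cinfinite_L large])
    fix \<eta> assume "\<eta> \<in> ?E"
    obtain c where "c \<in> C" using C(4)[of id] by auto
    moreover have "tail_equivalent (y c \<eta>) (y c \<eta>)" unfolding tail_equivalent_def by blast
    ultimately show "rel \<eta> \<eta>" unfolding rel_def by blast
  next
    fix \<eta> \<theta> assume "rel \<eta> \<theta>"
    then show "rel \<theta> \<eta>" unfolding rel_def tail_equivalent_def by metis
  next
    fix \<theta> assume \<theta>: "\<theta> \<in> ?E"
    \<comment> \<open>For fixed \<open>\<theta>\<close>, two members of \<open>C\<close> and two
      offsets leave at most one \<open>\<eta>\<close>, by \<open>y_inj\<close>.\<close>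
    define P where "P = (\<lambda>(c, d, i, j) \<eta>. \<eta> \<in> ?E \<and> (\<forall>k. y c \<eta> (i + k) = y d \<theta> (j + k)))"
    have "{\<eta> \<in> ?E. rel \<eta> \<theta>} \<subseteq> (\<lambda>p. THE \<eta>. P p \<eta>) ` (C \<times> C \<times> (UNIV :: nat set) \<times> (UNIV :: nat set))"
    proof
      fix \<eta> assume "\<eta> \<in> {\<eta> \<in> ?E. rel \<eta> \<theta>}"
      then obtain c d i j where p: "\<eta> \<in> ?E" "c \<in> C" "d \<in> C" "\<And>k. y c \<eta> (i + k) = y d \<theta> (j + k)"
        unfolding rel_def tail_equivalent_def by blast
      have "(THE \<eta>. P (c, d, i, j) \<eta>) = \<eta>"
      proof (rule the_equality)
        show "P (c, d, i, j) \<eta>" using p by (simp add: P_def)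
        fix \<zeta> assume "P (c, d, i, j) \<zeta>"
        then show "\<zeta> = \<eta>" using p by (intro y_inj[OF p(2), of \<zeta> \<eta> i]) (auto simp: P_def)
      qed
      then show "\<eta> \<in> (\<lambda>p. THE \<eta>. P p \<eta>) ` (C \<times> C \<times> (UNIV :: nat set) \<times> (UNIV :: nat set))"
        using p(2,3) by force
    qed
    then have "|{\<eta> \<in> ?E. rel \<eta> \<theta>}| \<le>o |C \<times> C \<times> (UNIV :: nat set) \<times> (UNIV :: nat set)|"
      by (rule surj_imp_ordLeq)
    also have "|C \<times> C \<times> (UNIV :: nat set) \<times> (UNIV :: nat set)| \<le>o |L|"
      using C(1) Cinfinite_L by (intro card_of_Times_bound card_of_nat_bound)
    finally show "|{\<eta> \<in> ?E. rel \<eta> \<theta>}| \<le>o |L|" .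
  qed
  then obtain K where K: "K \<subseteq> ?E" "pairwise (\<lambda>x y. \<not> rel x y) K" "|?E| \<le>o |K|" by blast
  define Y where "Y \<eta> = (\<lambda>c. y c \<eta>) ` C" for \<eta>
  show ?thesis
  proof (rule surjective_hom_of_guessing[where K = K and Y = Y])
    fix \<eta>
    have "|Y \<eta>| \<le>o |C|" unfolding Y_def by (rule card_of_image)
    then show "|Y \<eta>| \<le>o |L|" using C(1) ordLeq_transitive by blast
  next
    fix \<eta> t n assume "\<eta> \<in> K" "t \<in> Y \<eta>"
    then show "t n \<in> ladder_points" using C(3) codeN K(1) unfolding Y_def y_def by blast
  next
    fix \<eta> \<theta> s t assume "\<eta> \<in> K" "\<theta> \<in> K" "s \<in> Y \<eta>" "t \<in> Y \<theta>" "tail_equivalent s t"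
    then show "\<eta> = \<theta>" using K(2) unfolding pairwise_def rel_def Y_def by blast
  next
    fix \<eta> h assume \<eta>: "\<eta> \<in> K" and "h \<in> L \<rightarrow> L"
    then obtain c where c: "c \<in> C" "c ` N \<subseteq> Cl h" using C(4) by blast
    have "range (y c \<eta>) \<subseteq> Cl h" using c(2) codeN \<eta> K(1) unfolding y_def by blast
    then show "\<exists>t\<in>Y \<eta>. range t \<subseteq> Cl h" using c(1) unfolding Y_def by blast
  qed (use l K(3) in auto)
qed

end

text \<open>A copy of the type with a well-order as class instance, of which the cardinal will be an initial
  segment.\<close>

typedef 'a position = "UNIV :: 'a set" ..

instantiation position :: (type) wellorder
begin

definition less_eq_position :: "'a position \<Rightarrow> 'a position \<Rightarrow> bool" where
  "x \<le> y \<longleftrightarrow> (Rep_position x, Rep_position y) \<in> |UNIV :: 'a set|"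

definition less_position :: "'a position \<Rightarrow> 'a position \<Rightarrow> bool" where
  "x < y \<longleftrightarrow> x \<le> y \<and> x \<noteq> (y :: 'a position)"

instance
proof
  let ?W = "|UNIV :: 'a set|"
  have W: "refl ?W" "trans ?W" "antisym ?W" "total ?W" "wf (?W - Id)"
    using card_of_well_order_on[of "UNIV :: 'a set"]
    unfolding well_order_on_def linear_order_on_def partial_order_on_def preorder_on_def by auto
  fix x y z :: "'a position"
  show "x \<le> x" using W(1) by (simp add: less_eq_position_def refl_on_def)
  show "x \<le> y \<Longrightarrow> y \<le> z \<Longrightarrow> x \<le> z" using W(2) unfolding less_eq_position_def by (rule transD)
  show anti: "x \<le> y \<Longrightarrow> y \<le> x \<Longrightarrow> x = y"
    using W(3) unfolding less_eq_position_def by (simp add: antisymD flip: Rep_position_inject)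
  show "x \<le> y \<or> y \<le> x"
    using W(1,4) unfolding less_eq_position_def refl_on_def total_on_def by (metis UNIV_I)
  show "(x < y) = (x \<le> y \<and> \<not> y \<le> x)"
    using W(1) anti unfolding less_position_def by (auto simp: less_eq_position_def refl_on_def)
  fix P :: "'a position \<Rightarrow> bool" and a
  assume step: "\<And>x. (\<And>y. y < x \<Longrightarrow> P y) \<Longrightarrow> P x"
  have "\<forall>x. Rep_position x = u \<longrightarrow> P x" for u
  proof (induction u rule: wf_induct_rule[OF W(5)])
    case (1 u)
    have "P x" if x: "Rep_position x = u" for x
    proof (rule step)
      fix y assume "y < x"
      then have "(Rep_position y, u) \<in> ?W - Id"
        using x by (auto simp: less_position_def less_eq_position_def Rep_position_inject)
      then show "P y" using 1 by blast
    qed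
    then show ?case by blast
  qed
  then show "P a" by blast
qed

end

text \<open>The order of \<open>position\<close> copies the cardinal order \<open>|UNIV|\<close>,
  and the field of \<open>l\<close> is no larger than its type; hence \<open>l\<close> embeds as an
  initial segment.\<close>

lemma regular_cardinal_ex:
  fixes l :: "'l rel"
  assumes l: "Cinfinite l" "regularCard l" "natLeq <o l"
  shows "\<exists>L :: 'l position set. regular_cardinal L \<and> |L| =o l"
proof -
  let ?W = "|UNIV :: 'l set|"
  have wl: "Well_order l" using l(1) card_order_on_well_order_on by blast
  have "|Field l| \<le>o ?W" by (rule card_of_mono1) simp
  then have "l \<le>o ?W" using l(1) card_of_Field_ordIso ordIso_symmetric ordIso_ordLeq_trans by blast
  then obtain f where f: "embed l ?W f" unfolding ordLeq_def by blast
  define p where "p a = Abs_position (f a)" for a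
  define L where "L = p ` Field l"
  have Rep_p: "Rep_position (p a) = f a" for a by (simp add: p_def Abs_position_inverse)
  have inj: "inj_on p (Field l)"
    using embed_inj_on[OF wl f] by (simp add: inj_on_def p_def Abs_position_inject)
  have below: "{..<p a} = p ` underS l a" if a: "a \<in> Field l" for a
  proof -
    have "f ` underS l a = underS ?W (f a)" using embed_underS[OF wl f a] by (simp add: bij_betw_def)
    moreover have "x \<in> {..<p a} \<longleftrightarrow> Rep_position x \<in> underS ?W (f a)" for x
      unfolding lessThan_iff less_position_def less_eq_position_def underS_def Rep_position_inject[symmetric] Rep_p by blast
    moreover have "x \<in> p ` X \<longleftrightarrow> Rep_position x \<in> f ` X" for x X
      unfolding image_iff Rep_p[symmetric] Rep_position_inject ..
    ultimately show ?thesis by blast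
  qed
  have under_Field: "underS l a \<subseteq> Field l" for a unfolding underS_def Field_def by blast
  have "bij_betw p (Field l) L" using inj unfolding L_def bij_betw_def by blast
  then have "|L| =o |Field l|" using card_of_ordIsoI ordIso_symmetric by blast
  then have Ll: "|L| =o l" using l(1) card_of_Field_ordIso ordIso_transitive by blast
  have "regular_cardinal L"
  proof
    fix x y assume "y \<in> L" "x < y"
    then show "x \<in> L" using below under_Field unfolding L_def by blast
  next
    fix x assume "x \<in> L"
    then obtain a where a: "a \<in> Field l" "x = p a" unfolding L_def by blast
    have "|{..<x}| \<le>o |underS l a|" unfolding a(2) below[OF a(1)] by (rule card_of_image)
    also have "|underS l a| <o l" using l(1) a(1) by (simp add: card_of_underS)
    also have "l =o |L|" using Ll by (rule ordIso_symmetric)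
    finally show "|{..<x}| <o |L|" .
  next
    fix X assume X: "X \<subseteq> L" "|X| <o |L|"
    let ?X = "{a \<in> Field l. p a \<in> X}"
    have "|?X| \<le>o |X|" by (rule card_of_ordLeqI[of p]) (use inj in \<open>auto intro: inj_on_subset\<close>)
    also have "|X| <o |L|" by (rule X(2))
    also have "|L| =o l" by (rule Ll)
    finally have "\<not> |?X| =o l" by (rule not_ordLess_ordIso)
    moreover have "?X \<subseteq> Field l \<and> cofinal ?X l \<longrightarrow> |?X| =o l"
      using l(2) unfolding regularCard_def by (rule spec)
    moreover have "?X \<subseteq> Field l" by (rule Collect_restrict)
    ultimately have "\<not> cofinal ?X l" by blast
    then obtain a where a: "a \<in> Field l" "\<And>b. b \<in> ?X \<Longrightarrow> a = b \<or> (a, b) \<notin> l" unfolding cofinal_def by blast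
    \<comment> \<open>Failure of cofinality only puts the elements at or below \<open>a\<close>; a
      strict bound needs an element above \<open>a\<close>.\<close>
    obtain c where c: "c \<in> Field l" "a \<noteq> c" "(a, c) \<in> l"
      using infinite_Card_order_limit[of l a] l(1) a(1) by (auto simp: cinfinite_def)
    have tot: "total_on (Field l) l" and tr: "trans l" and anti: "antisym l"
      using wl unfolding well_order_on_def linear_order_on_def partial_order_on_def preorder_on_def by auto
    have "x < p c" if x: "x \<in> X" for x
    proof -
      obtain b where b: "b \<in> Field l" "x = p b" using x X(1) unfolding L_def by blast
      then have "a = b \<or> (b, a) \<in> l" using a x tot unfolding total_on_def by blast
      then have "b \<in> underS l c" using c tr anti unfolding underS_def
        by (auto dest: transD antisymD)
      then show ?thesis using below[OF c(1)] b(2) by blast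
    qed
    then show "\<exists>b\<in>L. \<forall>x\<in>X. x < b" using c(1) unfolding L_def by blast
  next
    show "natLeq <o |L|" using l(3) ordIso_symmetric[OF Ll] by (rule ordLess_ordIso_trans)
  qed
  then show ?thesis using Ll by blast
qed

theorem theorem2p4:
  fixes l :: "'l rel" and m :: "'m rel"
  assumes "Cinfinite l" and "regularCard l"
    and "Card_order m" and "cardSuc m <o l"
  shows "\<exists>\<Phi> :: 'l graph set \<Rightarrow> (nat \<Rightarrow> 'm) set.
    monotone_on (iso_types l) le_w (\<subseteq>) \<Phi> \<and>
    \<Phi> ` iso_types l = subsets_upto (m ^c natLeq) l"
proof -
  let ?E = "Func (UNIV :: nat set) (Field m)"
  have target: "subsets_upto (m ^c natLeq) l = {A. A \<subseteq> ?E \<and> |A| \<le>o l}"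
    unfolding subsets_upto_def cexp_def by (simp add: Field_card_of Field_natLeq)
  show ?thesis
  proof (cases "|?E| \<le>o |UNIV :: (nat \<Rightarrow> bool) set|")
    case True
    then show ?thesis using surjective_hom_binary[OF assms(1)] unfolding target by blast
  next
    case False
    \<comment> \<open>For finite \<mu> the exponent would be at most
      \<open>2\<^sup>\<omega>\<close>, which this case excludes. With \<mu> infinite, the gap below
      \<lambda> also makes \<lambda> uncountable.\<close>
    have inf: "infinite (Field m)"
    proof
      assume "finite (Field m)"
      then have "m ^c natLeq \<le>o ctwo ^c natLeq"
        using assms(3) by (intro Cfinite_cexp_Cinfinite natLeq_Cinfinite) (auto simp: cfinite_def)
      then have "|?E| \<le>o |Func (UNIV :: nat set) (UNIV :: bool set)|"
        unfolding cexp_def ctwo_def by (simp add: Field_card_of Field_natLeq)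
      also have "|Func (UNIV :: nat set) (UNIV :: bool set)| \<le>o |UNIV :: (nat \<Rightarrow> bool) set|"
        by (rule card_of_mono1) simp
      finally show False using False by blast
    qed
    have m: "|Field m| =o m" using assms(3) by (rule card_of_Field_ordIso)
    have "natLeq \<le>o |Field m|" using inf infinite_iff_natLeq_ordLeq by blast
    also have "|Field m| =o m" by (rule m)
    also have "m <o cardSuc m" using assms(3) by (rule cardSuc_greater)
    also have "cardSuc m <o l" by (rule assms(4))
    finally obtain L :: "'l position set" where L: "regular_cardinal L" "|L| =o l"
      using regular_cardinal_ex[OF assms(1,2)] by blast
    interpret regular_cardinal L by (rule L(1))
    have l: "Card_order l" using assms(1) by blast
    have "cardSuc |Field m| =o cardSuc m" using m assms(3) cardSuc_invar_ordIso card_of_Card_order by blast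
    also have "cardSuc m <o l" by (rule assms(4))
    also have "l =o |L|" using L(2) by (rule ordIso_symmetric)
    finally have suc: "cardSuc |Field m| <o |L|" .
    show ?thesis
    proof (cases "|?E| \<le>o |L|")
      case True
      then show ?thesis using surjective_hom_small[OF l L(2)] unfolding target by blast
    next
      case False
      then have "|L| <o |?E|" by (simp add: not_ordLeq_iff_ordLess card_of_Well_order)
      then show ?thesis using surjective_hom_large[OF l L(2) inf suc] unfolding target by blast
    qed
  qed
qed

end
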